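(* Let $N\ge2$ and let $\Omega\subset\mathbb{R}^N$ be a smooth bounded and convex domain. Then there exists a positive constant $C$ such that $$\Big\{\int_\Omega\Big(|\nabla u|^2-\frac{1}{4d^2(x)}u^2\Big)dx\Big\}\Big(\int_\Omega u^2dx\Big)^{\frac2N}\ \ge\ C\int_\Omega |u|^{2(1+\frac2N)}dx\qquad\text{for all }u\in C_0^\infty(\Omega).$$
   Context: "Smooth" domain means of class $C^2$. $d(x)=\mathrm{dist}(x,\partial\Omega)$. *)

theory Defs
  imports "HOL-Analysis.Analysis"
begin

definition partial_derivative :: "'n \<Rightarrow> (real ^ 'n \<Rightarrow> real) \<Rightarrow> real ^ 'n \<Rightarrow> real"
  where "partial_derivative i f x = frechet_derivative f (at x) (axis i 1)"

definition gradient :: "(real ^ 'n \<Rightarrow> real) \<Rightarrow> real ^ 'n \<Rightarrow> real ^ 'n"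
  where "gradient f x = (\<chi> i. partial_derivative i f x)"

lemma GDERIV_gradient:
  assumes "f differentiable (at x)"
  shows "GDERIV f x :> gradient f x"
proof -
  have D: "(f has_derivative frechet_derivative f (at x)) (at x)"
    using assms by (simp add: frechet_derivative_works)
  then have "linear (frechet_derivative f (at x))"
    by (rule has_derivative_linear)
  then have "frechet_derivative f (at x) (\<Sum>i\<in>UNIV. (h $ i) *\<^sub>R axis i 1) = h \<bullet> gradient f x" for h
    by (simp add: linear_sum linear_cmul inner_vec_def gradient_def partial_derivative_def)
  then have "frechet_derivative f (at x) = (\<lambda>h. h \<bullet> gradient f x)"
    by (simp add: fun_eq_iff basis_expansion flip: scalar_mult_eq_scaleR)
  with D show ?thesis by (simp add: gderiv_def)
qed

text \<open>Functions of class \<open>C\<^sup>k\<close> on all of \<open>\<real>\<^sup>n\<close>.\<close>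

fun C_k :: "nat \<Rightarrow> (real ^ 'n \<Rightarrow> real) \<Rightarrow> bool"
  where
    "C_k 0 f \<longleftrightarrow> continuous_on UNIV f"
  | "C_k (Suc k) f \<longleftrightarrow>
      (\<forall>x. f differentiable (at x)) \<and> (\<forall>i. C_k k (partial_derivative i f))"

text \<open>An element of \<open>C\<^sub>0\<^sup>\<infinity>(\<Omega>)\<close> is identified with its extension by zero to all of \<open>\<real>\<^sup>n\<close>.\<close>

definition test_functions :: "(real ^ 'n) set \<Rightarrow> (real ^ 'n \<Rightarrow> real) set"
  where "test_functions \<Omega> =
    {u. (\<forall>k. C_k k u) \<and> compact (closure {x. u x \<noteq> 0}) \<and> closure {x. u x \<noteq> 0} \<subseteq> \<Omega>}"

text \<open>
  \<open>C\<^sup>2\<close> boundary: near each boundary point, in suitable Cartesian coordinates, the set is the open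
  region lying strictly on one side of the graph of a \<open>C\<^sup>2\<close> function of \<open>n - 1\<close> variables. The
  unit vector \<open>e\<close> is the direction of the remaining coordinate, and a function of the other
  \<open>n - 1\<close> coordinates is a function on the whole space that is invariant along \<open>e\<close>.
\<close>

definition C2_boundary :: "(real ^ 'n) set \<Rightarrow> bool"
  where "C2_boundary \<Omega> \<longleftrightarrow>
    (\<forall>x0 \<in> frontier \<Omega>. \<exists>r > 0. \<exists>e \<gamma>.
       norm e = 1 \<and> C_k 2 \<gamma> \<and> (\<forall>x t. \<gamma> (x + t *\<^sub>R e) = \<gamma> x) \<and>
       \<Omega> \<inter> ball x0 r = {x \<in> ball x0 r. \<gamma> x < x \<bullet> e})"

definition smooth_domain :: "(real ^ 'n) set \<Rightarrow> bool"
  where "smooth_domain \<Omega> \<longleftrightarrow> open \<Omega> \<and> connected \<Omega> \<and> \<Omega> \<noteq> {} \<and> C2_boundary \<Omega>"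

definition bdist :: "(real ^ 'n) set \<Rightarrow> real ^ 'n \<Rightarrow> real"
  where "bdist \<Omega> x = infdist x (frontier \<Omega>)"

end

theory Submission
  imports Defs
begin

text \<open>
  Supporting half-spaces exhibit the distance \<open>d\<close> to the boundary as an infimum of affine functions
  with unit gradient. On the support of \<open>u\<close> it is approximated from below by a soft minimum \<open>D\<close> of
  finitely many of them, which is smooth and concave with \<open>|\<nabla>D| \<le> 1\<close> and
  \<open>\<Delta>D = - (1 - |\<nabla>D|\<^sup>2) / \<epsilon>\<close>.
  Put \<open>h = 1 / (2 D) - 1 / (4 R)\<close> with \<open>d \<le> R\<close>, and \<open>G = \<nabla>u - u h \<nabla>D\<close>. Integrating
  \<open>div (u\<^sup>2 h \<nabla>D)\<close> bounds \<open>\<integral> |G|\<^sup>2 + (3 / (16 R\<^sup>2)) \<integral> u\<^sup>2\<close> by the Hardy energy \<open>E\<close>.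
  Integrating \<open>div (|u|\<^sup>s (x0 - x))\<close>, where concavity gives \<open>\<nabla>D \<bullet> (x0 - x) \<ge> D(x0) - D(x)\<close>, bounds
  \<open>\<integral> h |u|\<^sup>s\<close> and hence \<open>\<integral> |\<nabla>|u|\<^sup>s|\<close> by a multiple of \<open>(E \<integral> |u|\<^bsup>2s-2\<^esup>)\<^bsup>1/2\<^esup>\<close>. For
  \<open>s = 2 + 2/N - 4/N\<^sup>2\<close> the Gagliardo--Nirenberg--Sobolev inequality for \<open>|u|\<^sup>s\<close> has
  \<open>\<integral> |u|\<^bsup>2+4/N\<^esup>\<close> on the left, and Hoelder interpolation of \<open>|u|\<^bsup>2s-2\<^esup>\<close> between \<open>u\<^sup>2\<close> and
  \<open>|u|\<^bsup>2+4/N\<^esup>\<close> concludes.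
\<close>

subsection \<open>The Gagliardo--Nirenberg--Sobolev inequality\<close>

text \<open>As \<^term>\<open>0 powr (0::real) = 0\<close>, the exponent 0 is treated separately: Hoelder's inequality below
  needs \<^term>\<open>epow x 0 = 1\<close> for all \<^term>\<open>x\<close>.\<close>

definition epow :: "ennreal \<Rightarrow> real \<Rightarrow> ennreal"
  where "epow x p = (if p = 0 then 1 else if x = \<infinity> then \<infinity> else ennreal (enn2real x powr p))"

lemma epow_measurable [measurable]: "(\<lambda>x. epow x p) \<in> borel_measurable borel"
  unfolding epow_def by measurable

lemma epow_0_right [simp]: "epow x 0 = 1"
  by (simp add: epow_def)

lemma epow_ennreal: "0 \<le> r \<Longrightarrow> p \<noteq> 0 \<Longrightarrow> epow (ennreal r) p = ennreal (r powr p)"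
  by (simp add: epow_def)

lemma epow_eq_0_iff: "epow x p = 0 \<longleftrightarrow> p \<noteq> 0 \<and> x = 0"
  by (cases x) (auto simp: epow_def)

lemma epow_add:
  assumes "0 \<le> a" "0 \<le> b"
  shows "epow x (a + b) = epow x a * epow x b"
  using assms by (cases x) (auto simp: epow_def powr_add ennreal_mult ennreal_top_mult add_nonneg_eq_0_iff)

lemma epow_mult:
  assumes "0 \<le> p"
  shows "epow (x * y) p = epow x p * epow y p"
proof (cases "p = 0")
  case False
  then show ?thesis
    using assms
    by (cases x; cases y)
       (auto simp: epow_def powr_mult ennreal_top_mult ennreal_mult_top ennreal_mult enn2real_mult
          simp flip: ennreal_mult)
qed simp

lemma epow_mono:
  assumes "x \<le> y" "0 \<le> p"
  shows "epow x p \<le> epow y p"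
proof (cases "y = \<infinity> \<or> p = 0")
  case False
  then have "y \<noteq> \<infinity>" "x \<noteq> \<infinity>" using assms by (auto simp: top_unique)
  then show ?thesis using assms
    by (cases x; cases y) (auto simp: epow_def intro!: powr_mono2)
qed (auto simp: epow_def)

section \<open>Weighted mean inequality and Hoelder's inequality with finitely many factors\<close>

text \<open>Weighted arithmetic-geometric mean inequality, from convexity of \<open>exp\<close>
  applied to the logarithms. Values 0 and infinity with a positive exponent are split off: infinity
  makes the right side infinite, and 0 makes the left side vanish.\<close>

lemma prod_epow_le_sum:
  assumes "finite I" and p: "\<And>i. i \<in> I \<Longrightarrow> 0 \<le> p i" "sum p I = 1"
  shows "(\<Prod>i\<in>I. epow (x i) (p i)) \<le> (\<Sum>i\<in>I. ennreal (p i) * x i)"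
proof -
  consider (inf) i where "i \<in> I" "p i > 0" "x i = \<infinity>"
    | (zero) i where "i \<in> I" "p i > 0" "x i = 0"
    | (fin) "\<And>i. i \<in> I \<Longrightarrow> p i = 0 \<or> x i \<noteq> \<infinity> \<and> x i \<noteq> 0"
    using p(1) by (metis less_eq_real_def)
  then show ?thesis
  proof cases
    case inf
    then have "ennreal (p i) * x i = \<infinity>" by (simp add: ennreal_mult_top)
    then have "(\<Sum>i\<in>I. ennreal (p i) * x i) = \<infinity>"
      using member_le_sum[of i I "\<lambda>i. ennreal (p i) * x i"] \<open>i \<in> I\<close> \<open>finite I\<close>
      by (simp add: top_unique)
    then show ?thesis by simp
  next
    case zero
    then have *: "(\<Prod>i\<in>I. epow (x i) (p i)) = 0"
      using \<open>finite I\<close> by (intro prod_zero) (auto simp: epow_eq_0_iff intro!: bexI[of _ i])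
    show ?thesis unfolding * by simp
  next
    case fin
    define y where "y i = ln (enn2real (x i))" for i
    have *: "epow (x i) (p i) = ennreal (exp (p i * y i)) \<and> ennreal (p i) * x i = ennreal (p i * exp (y i))"
      if "i \<in> I" for i
    proof (cases "p i = 0")
      case False
      with fin[OF that] have "x i \<noteq> \<infinity>" "x i \<noteq> 0" by auto
      then obtain r where "x i = ennreal r" "r > 0"
        by (metis ennreal_cases ennreal_0 infinity_ennreal_def less_eq_real_def)
      then show ?thesis
        using False p(1)[OF that] by (auto simp: epow_def y_def powr_def ennreal_mult)
    qed simp
    have "I \<noteq> {}" using p(2) by auto
    have "exp (\<Sum>i\<in>I. p i *\<^sub>R y i) \<le> (\<Sum>i\<in>I. p i * exp (y i))"
      by (intro convex_on_sum[OF \<open>finite I\<close> \<open>I \<noteq> {}\<close> exp_convex]) (use p in auto)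
    moreover have "(\<Prod>i\<in>I. epow (x i) (p i)) = ennreal (exp (\<Sum>i\<in>I. p i *\<^sub>R y i))"
      using * \<open>finite I\<close> by (simp add: exp_sum prod_ennreal)
    moreover have "(\<Sum>i\<in>I. ennreal (p i) * x i) = ennreal (\<Sum>i\<in>I. p i * exp (y i))"
      using * p(1) by (simp add: sum_ennreal)
    ultimately show ?thesis by (simp add: ennreal_leI)
  qed
qed

text \<open>Hoelder's inequality: once each function is divided by its integral, the pointwise
  weighted mean inequality has a right side that integrates to 1.\<close>

lemma nn_integral_prod_epow_le:
  assumes "finite I" and p: "\<And>i. i \<in> I \<Longrightarrow> 0 \<le> p i" "sum p I = 1"
    and f [measurable]: "\<And>i. i \<in> I \<Longrightarrow> f i \<in> borel_measurable M"
  shows "(\<integral>\<^sup>+x. (\<Prod>i\<in>I. epow (f i x) (p i)) \<partial>M) \<le> (\<Prod>i\<in>I. epow (\<integral>\<^sup>+x. f i x \<partial>M) (p i))"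
proof -
  consider (zero) i where "i \<in> I" "p i > 0" "(\<integral>\<^sup>+x. f i x \<partial>M) = 0"
    | (inf) i where "i \<in> I" "p i > 0" "(\<integral>\<^sup>+x. f i x \<partial>M) = \<infinity>"
        "\<And>j. j \<in> I \<Longrightarrow> p j = 0 \<or> (\<integral>\<^sup>+x. f j x \<partial>M) \<noteq> 0"
    | (fin) "\<And>i. i \<in> I \<Longrightarrow> p i = 0 \<or> (\<integral>\<^sup>+x. f i x \<partial>M) \<noteq> \<infinity> \<and> (\<integral>\<^sup>+x. f i x \<partial>M) \<noteq> 0"
    using p(1) by (metis less_eq_real_def)
  then show ?thesis
  proof cases
    case zero
    then have "AE x in M. f i x = 0" by (simp add: nn_integral_0_iff_AE)
    then have "AE x in M. (\<Prod>i\<in>I. epow (f i x) (p i)) = 0"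
      by eventually_elim (use zero \<open>finite I\<close> in \<open>intro prod_zero, auto simp: epow_eq_0_iff intro!: bexI[of _ i]\<close>)
    then have "(\<integral>\<^sup>+x. (\<Prod>i\<in>I. epow (f i x) (p i)) \<partial>M) = (\<integral>\<^sup>+x. 0 \<partial>M)"
      by (rule nn_integral_cong_AE)
    then show ?thesis by simp
  next
    \<comment> \<open>As infinity times 0 is 0 in \<open>ennreal\<close>, the right side is infinite
      only because no other factor vanishes; this is what the extra clause of the case
      provides.\<close>
    case inf
    have *: "(\<Prod>j\<in>I. epow (\<integral>\<^sup>+x. f j x \<partial>M) (p j)) =
        epow (\<integral>\<^sup>+x. f i x \<partial>M) (p i) * (\<Prod>j\<in>I - {i}. epow (\<integral>\<^sup>+x. f j x \<partial>M) (p j))"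
      using \<open>finite I\<close> \<open>i \<in> I\<close> by (rule prod.remove)
    have **: "(\<Prod>j\<in>I - {i}. epow (\<integral>\<^sup>+x. f j x \<partial>M) (p j)) \<noteq> 0"
      using inf(4) \<open>finite I\<close> by (auto simp: prod_zero_iff epow_eq_0_iff)
    have ***: "epow (\<integral>\<^sup>+x. f i x \<partial>M) (p i) = top"
      using inf by (simp add: epow_def)
    show ?thesis unfolding * *** using ** by (simp only: ennreal_top_mult if_False top_greatest)
  next
    case fin
    \<comment> \<open>A factor with exponent 0 equals 1 whatever its integral is, so its normalising
      constant is set to 1. This keeps every \<open>c i\<close> finite and nonzero.\<close>
    define c where "c i = (if p i = 0 then 1 else \<integral>\<^sup>+x. f i x \<partial>M)" for i
    have c: "c i \<noteq> \<infinity>" "c i \<noteq> 0" if "i \<in> I" for i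
      using fin[OF that] by (auto simp: c_def)
    have "(\<Prod>i\<in>I. epow (f i x) (p i)) \<le> (\<Prod>i\<in>I. epow (c i) (p i)) * (\<Sum>i\<in>I. ennreal (p i) * (f i x / c i))"
      for x
    proof -
      have "epow (f i x) (p i) = epow (c i) (p i) * epow (f i x / c i) (p i)" if "i \<in> I" for i
      proof -
        have "c i * (f i x / c i) = f i x"
          using c[OF that] mult_divide_eq_ennreal[of "c i" "f i x"]
          by (simp add: ennreal_times_divide mult.commute)
        then show ?thesis using epow_mult[OF p(1)[OF that]] by metis
      qed
      then have "(\<Prod>i\<in>I. epow (f i x) (p i)) = (\<Prod>i\<in>I. epow (c i) (p i)) * (\<Prod>i\<in>I. epow (f i x / c i) (p i))"
        by (simp add: prod.distrib)
      then show ?thesis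
        using prod_epow_le_sum[OF \<open>finite I\<close> p] by (simp add: mult_left_mono)
    qed
    then have "(\<integral>\<^sup>+x. (\<Prod>i\<in>I. epow (f i x) (p i)) \<partial>M)
        \<le> (\<integral>\<^sup>+x. (\<Prod>i\<in>I. epow (c i) (p i)) * (\<Sum>i\<in>I. ennreal (p i) * (f i x / c i)) \<partial>M)"
      by (intro nn_integral_mono)
    also have "\<dots> = (\<Prod>i\<in>I. epow (c i) (p i)) * (\<Sum>i\<in>I. ennreal (p i) * ((\<integral>\<^sup>+x. f i x \<partial>M) / c i))"
      by (subst nn_integral_cmult, measurable, subst nn_integral_sum, measurable)
         (simp add: nn_integral_cmult nn_integral_divide)
    also have "(\<Sum>i\<in>I. ennreal (p i) * ((\<integral>\<^sup>+x. f i x \<partial>M) / c i)) = (\<Sum>i\<in>I. ennreal (p i))"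
    proof (intro sum.cong refl)
      fix i assume "i \<in> I"
      then show "ennreal (p i) * ((\<integral>\<^sup>+x. f i x \<partial>M) / c i) = ennreal (p i)"
        using c[OF \<open>i \<in> I\<close>] by (auto simp: c_def less_top ennreal_divide_self)
    qed
    also have "\<dots> = 1" using p by (simp add: sum_ennreal)
    also have "(\<Prod>i\<in>I. epow (c i) (p i)) = (\<Prod>i\<in>I. epow (\<integral>\<^sup>+x. f i x \<partial>M) (p i))"
      by (intro prod.cong) (auto simp: c_def)
    finally show ?thesis by simp
  qed
qed

section \<open>A Loomis-Whitney type inequality for marginals and line integrals\<close>

lemma (in product_sigma_finite) measurable_marginal:
  assumes [measurable]: "g \<in> borel_measurable (Pi\<^sub>M (insert j I) M)"
  shows "(\<lambda>x. \<integral>\<^sup>+t. g (x(j := t)) \<partial>M j) \<in> borel_measurable (Pi\<^sub>M I M)"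
proof -
  interpret sigma_finite_measure "M j" by (rule sigma_finite_measures)
  show ?thesis by measurable
qed

text \<open>The Loomis--Whitney type inequality behind the Gagliardo--Nirenberg--Sobolev inequality. The
  factor with exponent \<^term>\<open>1 - (real (card I) - 1) * p\<close> makes the induction on \<^term>\<open>I\<close> work:
  integrating out one variable by Hoelder's inequality reproduces the statement for the marginal.\<close>

lemma (in product_sigma_finite) nn_integral_prod_marginals_le:
  assumes "finite I" "0 \<le> p" "(real (card I) - 1) * p \<le> 1"
    and "g \<in> borel_measurable (Pi\<^sub>M I M)"
  shows "(\<integral>\<^sup>+x. epow (g x) (1 - (real (card I) - 1) * p) *
            (\<Prod>i\<in>I. epow (\<integral>\<^sup>+t. g (x(i := t)) \<partial>M i) p) \<partial>Pi\<^sub>M I M)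
      \<le> epow (\<integral>\<^sup>+x. g x \<partial>Pi\<^sub>M I M) (1 + p)"
  using assms(1,3,4)
proof (induction I arbitrary: g rule: finite_induct)
  case empty
  then show ?case by (simp add: nn_integral_empty)
next
  case (insert j I)
  note [measurable] = \<open>g \<in> borel_measurable (Pi\<^sub>M (insert j I) M)\<close>
  interpret j: sigma_finite_measure "M j" by (rule sigma_finite_measures)
  define n where "n = real (card I)"
  define h where "h x = (\<integral>\<^sup>+t. g (x(j := t)) \<partial>M j)" for x
  have n: "real (card (insert j I)) - 1 = n" using insert by (simp add: n_def)
  have np: "n * p \<le> 1" using insert.prems n by simp
  have np1: "(n - 1) * p \<le> 1" using np \<open>0 \<le> p\<close> by (simp add: left_diff_distrib)
  have h_meas [measurable]: "h \<in> borel_measurable (Pi\<^sub>M I M)"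
    unfolding h_def by (rule measurable_marginal) measurable
  let ?F = "\<lambda>x. epow (g x) (1 - n * p) * (\<Prod>i\<in>insert j I. epow (\<integral>\<^sup>+t. g (x(i := t)) \<partial>M i) p)"
  have marg [measurable]: "(\<lambda>x. \<integral>\<^sup>+t. g (x(i := t)) \<partial>M i) \<in> borel_measurable (Pi\<^sub>M (insert j I) M)"
    if "i \<in> insert j I" for i
    by (rule measurable_marginal) (use that in \<open>simp add: insert_absorb\<close>)
  have "(\<integral>\<^sup>+x. ?F x \<partial>Pi\<^sub>M (insert j I) M) = (\<integral>\<^sup>+x. (\<integral>\<^sup>+t. ?F (x(j := t)) \<partial>M j) \<partial>Pi\<^sub>M I M)"
    by (rule product_nn_integral_insert[OF insert.hyps]) measurable
  also have "\<dots> \<le> (\<integral>\<^sup>+x. epow (h x) (1 - (n - 1) * p) *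
      (\<Prod>i\<in>I. epow (\<integral>\<^sup>+r. h (x(i := r)) \<partial>M i) p) \<partial>Pi\<^sub>M I M)"
  proof (rule nn_integral_mono)
    fix x assume x: "x \<in> space (Pi\<^sub>M I M)"
    have [measurable]: "(\<lambda>t. x(j := t)) \<in> measurable (M j) (Pi\<^sub>M (insert j I) M)"
      using x insert by (intro measurable_component_update) auto
    \<comment> \<open>Set-up for Hoelder in the variable \<open>t\<close>: \<open>g\<close> takes
      the exponent \<open>1 - n * p\<close> left over by the \<open>n\<close> marginals in the
      directions of \<open>I\<close>, so that the exponents \<open>q\<close> add up to 1.\<close>
    define f where "f i t = (if i = j then g (x(j := t)) else \<integral>\<^sup>+r. g (x(j := t, i := r)) \<partial>M i)" for i t
    define q where "q i = (if i = j then 1 - n * p else p)" for i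
    have [measurable]: "f i \<in> borel_measurable (M j)" if "i \<in> insert j I" for i
    proof (cases "i = j")
      case False
      have "(\<lambda>t. (\<lambda>y. \<integral>\<^sup>+r. g (y(i := r)) \<partial>M i) (x(j := t))) \<in> borel_measurable (M j)"
        by (rule measurable_compose[OF _ marg[OF that]]) measurable
      then show ?thesis using False by (simp add: f_def[abs_def])
    qed (simp add: f_def[abs_def])
    \<comment> \<open>By Tonelli, integrating a marginal of \<open>g\<close> over the new variable
      gives the corresponding marginal of \<open>h\<close>.\<close>
    have fint: "(\<integral>\<^sup>+t. f i t \<partial>M j) = (\<integral>\<^sup>+r. h (x(i := r)) \<partial>M i)" if "i \<in> I" for i
    proof -
      have "i \<noteq> j" using that insert by auto
      interpret i: sigma_finite_measure "M i" by (rule sigma_finite_measures)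
      interpret ij: pair_sigma_finite "M j" "M i" ..
      have "(\<lambda>(y, r). y(i := r)) \<in> measurable (Pi\<^sub>M (insert j I) M \<Otimes>\<^sub>M M i) (Pi\<^sub>M (insert i (insert j I)) M)"
        by measurable
      moreover have "insert i (insert j I) = insert j I" using that by auto
      ultimately have [measurable]: "(\<lambda>(y, r). y(i := r)) \<in> measurable (Pi\<^sub>M (insert j I) M \<Otimes>\<^sub>M M i) (Pi\<^sub>M (insert j I) M)"
        by simp
      have "(\<lambda>(t, r). ((x(j := t))(i := r))) \<in> measurable (M j \<Otimes>\<^sub>M M i) (Pi\<^sub>M (insert j I) M)"
      proof -
        have "(\<lambda>z. (\<lambda>(y, r). y(i := r)) (x(j := fst z), snd z)) \<in> measurable (M j \<Otimes>\<^sub>M M i) (Pi\<^sub>M (insert j I) M)"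
          by (rule measurable_compose[where N = "Pi\<^sub>M (insert j I) M \<Otimes>\<^sub>M M i"]) measurable
        then show ?thesis by (simp add: case_prod_unfold)
      qed
      then have m: "(\<lambda>(t, r). g (x(j := t, i := r))) \<in> borel_measurable (M j \<Otimes>\<^sub>M M i)"
        by measurable
      have "(\<integral>\<^sup>+t. f i t \<partial>M j) = (\<integral>\<^sup>+t. (\<integral>\<^sup>+r. g (x(j := t, i := r)) \<partial>M i) \<partial>M j)"
        using \<open>i \<noteq> j\<close> by (simp add: f_def)
      also have "\<dots> = (\<integral>\<^sup>+r. (\<integral>\<^sup>+t. g (x(j := t, i := r)) \<partial>M j) \<partial>M i)"
        using ij.Fubini'[OF m] by simp
      also have "\<dots> = (\<integral>\<^sup>+r. h (x(i := r)) \<partial>M i)"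
        using \<open>i \<noteq> j\<close> by (simp add: h_def fun_upd_twist)
      finally show ?thesis .
    qed
    have split: "(\<Prod>i\<in>insert j I. epow (F i) (q i)) = epow (F j) (1 - n * p) * (\<Prod>i\<in>I. epow (F i) p)"
      for F :: "_ \<Rightarrow> ennreal"
      using insert.hyps by (auto simp: q_def intro!: arg_cong2[where f = "(*)"] prod.cong)
    \<comment> \<open>The marginal in direction \<open>j\<close> does not depend on
      \<open>t\<close>; its factor \<open>epow (h x) p\<close> can leave the integral.\<close>
    have "?F (x(j := t)) = epow (h x) p * (\<Prod>i\<in>insert j I. epow (f i t) (q i))" for t
    proof -
      have "(\<Prod>i\<in>I. epow (\<integral>\<^sup>+r. g (x(j := t, i := r)) \<partial>M i) p) = (\<Prod>i\<in>I. epow (f i t) p)"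
        using insert.hyps by (intro prod.cong) (auto simp: f_def)
      moreover have "f j t = g (x(j := t))" by (simp add: f_def)
      ultimately show ?thesis
        unfolding split using insert.hyps by (simp add: h_def mult_ac)
    qed
    then have "(\<integral>\<^sup>+t. ?F (x(j := t)) \<partial>M j) = epow (h x) p * (\<integral>\<^sup>+t. (\<Prod>i\<in>insert j I. epow (f i t) (q i)) \<partial>M j)"
      by (simp add: nn_integral_cmult)
    also have "\<dots> \<le> epow (h x) p * (\<Prod>i\<in>insert j I. epow (\<integral>\<^sup>+t. f i t \<partial>M j) (q i))"
    proof (intro mult_left_mono nn_integral_prod_epow_le)
      have "sum q I = (\<Sum>i\<in>I. p)"
        using insert.hyps by (intro sum.cong) (auto simp: q_def)
      then have "sum q (insert j I) = (1 - n * p) + (\<Sum>i\<in>I. p)"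
        using insert.hyps by (simp add: q_def)
      then show "sum q (insert j I) = 1" by (simp add: n_def)
    qed (use insert.hyps np \<open>0 \<le> p\<close> in \<open>auto simp: q_def\<close>)
    also have "\<dots> = epow (h x) p * (epow (h x) (1 - n * p) * (\<Prod>i\<in>I. epow (\<integral>\<^sup>+r. h (x(i := r)) \<partial>M i) p))"
    proof -
      have "(\<integral>\<^sup>+t. f j t \<partial>M j) = h x" by (simp add: f_def h_def)
      then show ?thesis unfolding split using fint by simp
    qed
    \<comment> \<open>The exponents \<open>p\<close> and \<open>1 - n * p\<close> of
      \<open>h x\<close> merge into the one that the induction hypothesis expects for an index set
      with one element less.\<close>
    also have "\<dots> = epow (h x) (1 - (n - 1) * p) * (\<Prod>i\<in>I. epow (\<integral>\<^sup>+r. h (x(i := r)) \<partial>M i) p)"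
      using epow_add[of p "1 - n * p" "h x"] np \<open>0 \<le> p\<close> by (simp add: algebra_simps)
    finally show "(\<integral>\<^sup>+t. ?F (x(j := t)) \<partial>M j)
       \<le> epow (h x) (1 - (n - 1) * p) * (\<Prod>i\<in>I. epow (\<integral>\<^sup>+r. h (x(i := r)) \<partial>M i) p)" .
  qed
  also have "\<dots> \<le> epow (\<integral>\<^sup>+x. h x \<partial>Pi\<^sub>M I M) (1 + p)"
    using insert.IH[OF np1[unfolded n_def] h_meas] unfolding n_def .
  also have "(\<integral>\<^sup>+x. h x \<partial>Pi\<^sub>M I M) = (\<integral>\<^sup>+x. g x \<partial>Pi\<^sub>M (insert j I) M)"
    unfolding h_def by (rule product_nn_integral_insert[OF insert.hyps, symmetric]) measurable
  finally show ?case by (simp only: n)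
qed

text \<open>The choice of \<open>p\<close> makes the exponent of the function itself vanish in the
  marginal inequality, so only the marginals remain. They are the line integrals in the coordinate
  directions once Lebesgue measure is written as a product measure.\<close>

lemma nn_integral_prod_line_integrals_le:
  fixes \<phi> :: "'a::euclidean_space \<Rightarrow> ennreal"
  assumes [measurable]: "\<phi> \<in> borel_measurable borel" and dim: "DIM('a) \<ge> 2"
  defines "p \<equiv> 1 / (real DIM('a) - 1)"
  shows "(\<integral>\<^sup>+y. (\<Prod>b\<in>Basis. epow (\<integral>\<^sup>+t. \<phi> (y + t *\<^sub>R b) \<partial>lborel) p) \<partial>lborel)
      \<le> epow (\<integral>\<^sup>+y. \<phi> y \<partial>lborel) (1 + p)"
proof -
  interpret product_sigma_finite "\<lambda>_::'a. lborel::real measure" ..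
  define P where "P = (\<Pi>\<^sub>M b\<in>(Basis::'a set). lborel :: real measure)"
  define s where "s x = (\<Sum>b\<in>Basis. x b *\<^sub>R b)" for x :: "'a \<Rightarrow> real"
  have s_meas [measurable]: "s \<in> borel_measurable P"
    unfolding s_def[abs_def] P_def by measurable
  have distr: "(\<integral>\<^sup>+y. \<psi> y \<partial>lborel) = (\<integral>\<^sup>+x. \<psi> (s x) \<partial>P)" if [measurable]: "\<psi> \<in> borel_measurable borel"
    for \<psi> :: "'a \<Rightarrow> ennreal"
    by (subst lborel_eq[where 'a = 'a], subst nn_integral_distr)
       (use s_meas in \<open>auto simp: P_def s_def[abs_def]\<close>)
  have upd: "s (x(b := t)) = s x + (t - x b) *\<^sub>R b" if "b \<in> Basis" for x b t
  proof -
    have "s (x(b := t)) = t *\<^sub>R b + (\<Sum>b\<in>Basis - {b}. x b *\<^sub>R b)"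
      unfolding s_def using that
      by (subst sum.remove[OF finite_Basis that]) (auto intro!: sum.cong)
    moreover have "s x = x b *\<^sub>R b + (\<Sum>b\<in>Basis - {b}. x b *\<^sub>R b)"
      unfolding s_def by (rule sum.remove[OF finite_Basis that])
    ultimately show ?thesis by (simp add: algebra_simps)
  qed
  \<comment> \<open>A marginal is parametrised by the absolute coordinate, a line integral by the
    displacement from the base point; translation invariance identifies them.\<close>
  have line: "(\<integral>\<^sup>+t. \<phi> (s (x(b := t))) \<partial>lborel) = (\<integral>\<^sup>+t. \<phi> (s x + t *\<^sub>R b) \<partial>lborel)" if "b \<in> Basis" for x b
    unfolding upd[OF that]
    using nn_integral_real_affine[of "\<lambda>t. \<phi> (s x + t *\<^sub>R b)" 1 "- x b"]
    by (simp add: algebra_simps)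
  have p: "0 \<le> p" "(real (card (Basis :: 'a set)) - 1) * p = 1"
    using dim by (auto simp: p_def)
  have "(\<integral>\<^sup>+y. (\<Prod>b\<in>Basis. epow (\<integral>\<^sup>+t. \<phi> (y + t *\<^sub>R b) \<partial>lborel) p) \<partial>lborel)
      = (\<integral>\<^sup>+x. epow (\<phi> (s x)) (1 - (real (card (Basis :: 'a set)) - 1) * p) *
          (\<Prod>b\<in>Basis. epow (\<integral>\<^sup>+t. \<phi> (s (x(b := t))) \<partial>lborel) p) \<partial>P)"
    by (subst distr) (auto simp: line p cong: prod.cong)
  also have "\<dots> \<le> epow (\<integral>\<^sup>+x. \<phi> (s x) \<partial>P) (1 + p)"
    unfolding P_def
    by (rule nn_integral_prod_marginals_le) (use p s_meas in \<open>auto simp: P_def\<close>)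
  finally show ?thesis by (simp add: distr)
qed

lemma prod_mono_ennreal:
  fixes f g :: "'a \<Rightarrow> ennreal"
  assumes "\<And>i. i \<in> I \<Longrightarrow> f i \<le> g i"
  shows "prod f I \<le> prod g I"
  using assms by (induction I rule: infinite_finite_induct) (auto intro!: mult_mono)

lemma epow_power:
  assumes "0 \<le> r" "p \<noteq> 0" "n \<noteq> 0"
  shows "epow (ennreal r) p ^ n = ennreal (r powr (real n * p))"
proof -
  have "(r powr p) ^ n = r powr (real n * p)"
    using assms by (cases "r = 0") (auto simp: powr_power mult.commute)
  then show ?thesis using assms by (simp add: epow_ennreal ennreal_power)
qed

lemma integrable_lborel_compact_support:
  fixes f :: "'a::euclidean_space \<Rightarrow> real"
  assumes "compact K" "continuous_on K f" "\<And>x. x \<notin> K \<Longrightarrow> f x = 0"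
  shows "integrable lborel f"
proof -
  have "integrable lborel (\<lambda>x. indicator K x *\<^sub>R f x)"
    by (rule borel_integrable_compact) (use assms in auto)
  also have "(\<lambda>x. indicator K x *\<^sub>R f x) = f"
    using assms(3) by (auto simp: indicator_def fun_eq_iff)
  finally show ?thesis .
qed

lemma has_derivative_zero_outside_support:
  fixes f :: "'a::euclidean_space \<Rightarrow> real"
  assumes "(f has_derivative D) (at x)" "closed K" "\<And>x. x \<notin> K \<Longrightarrow> f x = 0" "x \<notin> K"
  shows "D v = 0"
proof -
  have "((\<lambda>x. 0) has_derivative D) (at x)"
    by (rule has_derivative_transform_within_open[OF assms(1), of "- K"]) (use assms in auto)
  then have "D = (\<lambda>x. 0)"
    using has_derivative_const has_derivative_unique by blast
  then show ?thesis by simp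
qed

lemma has_derivative_along_line:
  fixes f :: "'a::euclidean_space \<Rightarrow> real"
  assumes "\<And>x. (f has_derivative f' x) (at x)"
  shows "((\<lambda>t. f (y + t *\<^sub>R b)) has_real_derivative f' (y + t *\<^sub>R b) b) (at t)"
proof -
  have lin: "linear (f' (y + t *\<^sub>R b))" by (rule has_derivative_linear[OF assms])
  have "((\<lambda>t. y + t *\<^sub>R b) has_derivative (\<lambda>h. h *\<^sub>R b)) (at t)"
    by (auto intro!: derivative_eq_intros)
  from has_derivative_compose[OF this assms]
  have "((\<lambda>t. f (y + t *\<^sub>R b)) has_derivative (\<lambda>h. f' (y + t *\<^sub>R b) (h *\<^sub>R b))) (at t)" .
  moreover have "(\<lambda>h. f' (y + t *\<^sub>R b) (h *\<^sub>R b)) = (*) (f' (y + t *\<^sub>R b) b)"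
    by (auto simp: fun_eq_iff linear_cmul[OF lin])
  ultimately show ?thesis by (simp add: has_field_derivative_def)
qed

text \<open>Fundamental theorem of calculus along the line through \<open>y\<close>, started at a
  point outside the support, where \<open>f\<close> vanishes.\<close>

lemma le_line_integral:
  fixes f :: "'a::euclidean_space \<Rightarrow> real"
  assumes f: "\<And>x. (f has_derivative f' x) (at x)"
    and cont: "continuous_on UNIV g" and le: "\<And>x. \<bar>f' x b\<bar> \<le> g x"
    and K: "bounded K" "\<And>x. x \<notin> K \<Longrightarrow> f x = 0" and "b \<noteq> 0"
  shows "ennreal \<bar>f y\<bar> \<le> (\<integral>\<^sup>+t. ennreal (g (y + t *\<^sub>R b)) \<partial>lborel)"
proof -
  obtain R where R: "\<And>x. x \<in> K \<Longrightarrow> norm x \<le> R" using K(1) by (auto simp: bounded_iff)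
  \<comment> \<open>Large enough that \<open>y - T *\<^sub>R b\<close> has norm greater than
    \<open>R\<close> and so lies outside \<open>K\<close>.\<close>
  define T where "T = (\<bar>R\<bar> + norm y + 1) / norm b"
  have "T > 0" using \<open>b \<noteq> 0\<close> by (auto simp: T_def intro!: divide_pos_pos add_nonneg_pos)
  have "norm (T *\<^sub>R b) = \<bar>R\<bar> + norm y + 1"
    using \<open>b \<noteq> 0\<close> \<open>T > 0\<close> by (simp add: T_def)
  then have "norm (y + (- T) *\<^sub>R b) > R"
    using norm_triangle_ineq2[of "T *\<^sub>R b" y] by (simp add: norm_minus_commute)
  then have zero: "f (y + (- T) *\<^sub>R b) = 0" using R K(2) by fastforce
  let ?G = "\<lambda>t. g (y + t *\<^sub>R b)"
  have G: "continuous_on A ?G" for A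
    by (rule continuous_on_compose2[OF cont]) (auto intro!: continuous_intros)
  have G_meas [measurable]: "?G \<in> borel_measurable borel"
    by (rule borel_measurable_continuous_onI[OF G])
  have G0: "0 \<le> ?G t" for t using le[of "y + t *\<^sub>R b"] by linarith
  have int: "((\<lambda>t. f' (y + t *\<^sub>R b) b) has_integral (f (y + 0 *\<^sub>R b) - f (y + (- T) *\<^sub>R b))) {-T..0}"
    by (rule fundamental_theorem_of_calculus)
       (use \<open>T > 0\<close> has_derivative_along_line[OF f]
         in \<open>auto simp flip: has_real_derivative_iff_has_vector_derivative intro: has_field_derivative_at_within\<close>)
  have "\<bar>f y\<bar> \<le> integral {-T..0} ?G"
    using integral_norm_bound_integral[of "\<lambda>t. f' (y + t *\<^sub>R b) b" "{-T..0}" ?G]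
      int integrable_continuous_real[OF G] le zero
    by (auto simp: has_integral_iff)
  moreover have "(\<integral>\<^sup>+t. ennreal (if t \<in> {-T..0} then ?G t else 0) \<partial>lborel) = ennreal (integral {-T..0} ?G)"
  proof (rule nn_integral_has_integral_lborel)
    show "((\<lambda>t. if t \<in> {-T..0} then ?G t else 0) has_integral integral {-T..0} ?G) UNIV"
      unfolding has_integral_restrict_UNIV
      by (rule integrable_integral[OF integrable_continuous_real[OF G]])
  qed (use G0 in auto)
  moreover have "(\<integral>\<^sup>+t. ennreal (if t \<in> {-T..0} then ?G t else 0) \<partial>lborel) \<le> (\<integral>\<^sup>+t. ennreal (?G t) \<partial>lborel)"
    by (intro nn_integral_mono ennreal_leI) (auto simp: G0)
  ultimately show ?thesis by (metis ennreal_leI order_trans)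
qed

text \<open>With one factor \<open>\<bar>f y\<bar> powr p\<close> per coordinate direction, where
  \<open>p = 1 / (real DIM('a) - 1)\<close>, the product is \<open>\<bar>f y\<bar> powr q\<close>.
  Each factor is bounded by a line integral of \<open>g\<close>, and the inequality for products of
  line integrals applies. In the application \<open>g\<close> is the norm of the gradient.\<close>

lemma gagliardo_nirenberg_sobolev:
  fixes f :: "'a::euclidean_space \<Rightarrow> real"
  assumes dim: "DIM('a) \<ge> 2"
    and f: "\<And>x. (f has_derivative f' x) (at x)"
    and g: "continuous_on UNIV g" "\<And>x b. b \<in> Basis \<Longrightarrow> \<bar>f' x b\<bar> \<le> g x"
    and K: "compact K" "\<And>x. x \<notin> K \<Longrightarrow> f x = 0" "\<And>x. x \<notin> K \<Longrightarrow> g x = 0"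
  defines "q \<equiv> real DIM('a) / (real DIM('a) - 1)"
  shows "(LINT x|lborel. \<bar>f x\<bar> powr q) \<le> (LINT x|lborel. g x) powr q"
proof -
  define p where "p = 1 / (real DIM('a) - 1)"
  have p: "1 + p = q" "real DIM('a) * p = q" "p \<noteq> 0" "q > 0"
    using dim by (auto simp: p_def q_def field_simps)
  have contf: "continuous_on UNIV f"
    by (intro continuous_at_imp_continuous_on ballI has_derivative_continuous[OF f])
  have [measurable]: "f \<in> borel_measurable borel" "g \<in> borel_measurable borel"
    using contf g(1) by (auto intro: borel_measurable_continuous_onI)
  have g0: "0 \<le> g x" for x
    using g(2)[OF SOME_Basis, of x] by linarith
  have ig: "integrable lborel g"
    by (rule integrable_lborel_compact_support[OF K(1)]) (use g K in \<open>auto intro: continuous_on_subset\<close>)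
  have "(\<integral>\<^sup>+x. ennreal (\<bar>f x\<bar> powr q) \<partial>lborel)
      \<le> (\<integral>\<^sup>+y. (\<Prod>b\<in>Basis. epow (\<integral>\<^sup>+t. ennreal (g (y + t *\<^sub>R b)) \<partial>lborel) p) \<partial>lborel)"
  proof (rule nn_integral_mono)
    fix y :: 'a
    have "ennreal (\<bar>f y\<bar> powr q) = (\<Prod>b\<in>(Basis::'a set). epow (ennreal \<bar>f y\<bar>) p)"
      using p by (simp add: epow_power)
    also have "\<dots> \<le> (\<Prod>b\<in>Basis. epow (\<integral>\<^sup>+t. ennreal (g (y + t *\<^sub>R b)) \<partial>lborel) p)"
      by (intro prod_mono_ennreal epow_mono le_line_integral[OF f g(1) g(2) compact_imp_bounded[OF K(1)] K(2)])
         (use dim in \<open>auto simp: p_def\<close>)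
    finally show "ennreal (\<bar>f y\<bar> powr q) \<le> (\<Prod>b\<in>Basis. epow (\<integral>\<^sup>+t. ennreal (g (y + t *\<^sub>R b)) \<partial>lborel) p)" .
  qed
  also have "\<dots> \<le> epow (\<integral>\<^sup>+y. ennreal (g y) \<partial>lborel) (1 + p)"
    unfolding p_def by (rule nn_integral_prod_line_integrals_le) (use dim in auto)
  also have "(\<integral>\<^sup>+y. ennreal (g y) \<partial>lborel) = ennreal (LINT x|lborel. g x)"
    by (rule nn_integral_eq_integral[OF ig]) (use g0 in auto)
  also have "epow (ennreal (LINT x|lborel. g x)) (1 + p) = ennreal ((LINT x|lborel. g x) powr q)"
    using p g0 by (simp add: epow_ennreal)
  finally have "(\<integral>\<^sup>+x. ennreal (\<bar>f x\<bar> powr q) \<partial>lborel) \<le> ennreal ((LINT x|lborel. g x) powr q)" .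
  moreover have "(LINT x|lborel. \<bar>f x\<bar> powr q) = enn2real (\<integral>\<^sup>+x. ennreal (\<bar>f x\<bar> powr q) \<partial>lborel)"
    by (rule integral_eq_nn_integral) auto
  ultimately show ?thesis
    by (simp add: enn2real_leI)
qed

subsection \<open>The divergence theorem for compactly supported fields\<close>

text \<open>By translation invariance every difference quotient of \<^term>\<open>w\<close> has integral zero.\<close>

lemma integral_directional_derivative_eq_0:
  fixes w :: "'a::euclidean_space \<Rightarrow> real"
  assumes w: "\<And>x. (w has_derivative w' x) (at x)"
    and cont: "continuous_on UNIV (\<lambda>x. w' x e)"
    and K: "compact K" "\<And>x. x \<notin> K \<Longrightarrow> w x = 0"
  shows "(LINT x|lborel. w' x e) = 0"
proof -
  have contw: "continuous_on UNIV w"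
    by (intro continuous_at_imp_continuous_on ballI has_derivative_continuous[OF w])
  have [measurable]: "w \<in> borel_measurable borel" "(\<lambda>x. w' x e) \<in> borel_measurable borel"
    using contw cont by (auto intro: borel_measurable_continuous_onI)
  have intw: "integrable lborel w"
    by (rule integrable_lborel_compact_support[OF K(1)]) (use contw K in \<open>auto intro: continuous_on_subset\<close>)
  obtain R where R: "\<And>x. x \<in> K \<Longrightarrow> norm x \<le> R"
    using compact_imp_bounded[OF K(1)] by (auto simp: bounded_iff)
  have "bounded ((\<lambda>x. w' x e) ` K)"
    by (rule compact_imp_bounded, rule compact_continuous_image[OF _ K(1)]) (use cont in \<open>auto intro: continuous_on_subset\<close>)
  then obtain B0 where B0: "\<And>x. x \<in> K \<Longrightarrow> \<bar>w' x e\<bar> \<le> B0"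
    by (auto simp: bounded_iff)
  define B where "B = \<bar>B0\<bar>"
  have B: "\<bar>w' x e\<bar> \<le> B" for x
    using B0[of x] has_derivative_zero_outside_support[OF w compact_imp_closed[OF K(1)] K(2), of x e]
    by (cases "x \<in> K") (auto simp: B_def)
  define t where "t n = inverse (real (Suc n))" for n
  have t: "0 < t n" "t n \<le> 1" for n by (auto simp: t_def inverse_le_1_iff)
  have t0: "t \<longlonglongrightarrow> 0" unfolding t_def by (rule LIMSEQ_inverse_real_of_nat)
  define s where "s n x = (w (x + t n *\<^sub>R e) - w x) / t n" for n x
  have [measurable]: "s n \<in> borel_measurable borel" for n
    unfolding s_def[abs_def] by measurable
  have trans: "(LINT x|lborel. w (x + c)) = (LINT x|lborel. w x)" "integrable lborel (\<lambda>x. w (x + c))" for c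
  proof -
    have "(LINT x|distr lborel borel (\<lambda>x::'a. c + x). w x) = (LINT x|lborel. w (c + x))"
      by (rule integral_distr) auto
    then show "(LINT x|lborel. w (x + c)) = (LINT x|lborel. w x)"
      unfolding lborel_distr_plus by (simp add: add.commute)
    have "integrable (distr lborel borel (\<lambda>x::'a. c + x)) w"
      using intw by (simp add: lborel_distr_plus)
    then show "integrable lborel (\<lambda>x. w (x + c))"
      by (subst (asm) integrable_distr_eq) (auto simp: add.commute)
  qed
  have ints: "(LINT x|lborel. s n x) = 0" for n
    unfolding s_def using trans intw by (simp add: Bochner_Integration.integral_diff)
  have lim: "(\<lambda>n. s n x) \<longlonglongrightarrow> w' x e" for x
  proof -
    have "((\<lambda>h. (w (x + h *\<^sub>R e) - w x) / h) \<longlongrightarrow> w' x e) (at 0)"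
      using has_derivative_along_line[OF w, of x e 0] by (simp add: DERIV_def)
    moreover have "filterlim t (at 0) sequentially"
      using t0 t(1) by (auto simp: filterlim_at less_imp_neq[THEN not_sym] intro!: always_eventually)
    ultimately show ?thesis unfolding s_def by (rule filterlim_compose)
  qed
  \<comment> \<open>A majorant for dominated convergence: the mean value theorem bounds the
    quotients by \<open>B\<close>, and as \<open>t n \<le> 1\<close> they vanish outside the ball of
    radius \<open>R + norm e\<close>.\<close>
  have bound: "norm (s n x) \<le> B * indicator (cball (0::'a) (R + norm e)) x" for n x
  proof (cases "norm x \<le> R + norm e")
    case True
    have "\<exists>z>0. z < t n \<and> w (x + t n *\<^sub>R e) - w (x + 0 *\<^sub>R e) = (t n - 0) * w' (x + z *\<^sub>R e) e"
      by (rule MVT2[OF t(1)]) (rule has_derivative_along_line[OF w])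
    then obtain z where "w (x + t n *\<^sub>R e) - w x = t n * w' (x + z *\<^sub>R e) e" by auto
    then have "s n x = w' (x + z *\<^sub>R e) e" using t(1)[of n] by (simp add: s_def)
    then show ?thesis using B True by simp
  next
    case False
    have "norm (t n *\<^sub>R e) \<le> norm e"
      using t[of n] by (simp add: mult_left_le_one_le)
    then have "norm (x + t n *\<^sub>R e) > R"
      using False norm_diff_ineq[of x "t n *\<^sub>R e"] by linarith
    moreover have "norm x > R" using False norm_ge_zero[of e] by linarith
    ultimately have "w x = 0" "w (x + t n *\<^sub>R e) = 0" using R K(2) by force+
    then show ?thesis by (simp add: s_def B_def)
  qed
  have "(\<lambda>n. LINT x|lborel. s n x) \<longlonglongrightarrow> (LINT x|lborel. w' x e)"
  proof (rule integral_dominated_convergence[where w = "\<lambda>x. B * indicator (cball (0::'a) (R + norm e)) x"])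
    show "integrable lborel (\<lambda>x. B * indicator (cball (0::'a) (R + norm e)) x)"
      by (intro integrable_mult_right integrable_real_indicator)
         (use emeasure_bounded_finite[of "cball (0::'a) (R + norm e)"] in auto)
  next
    show "AE x in lborel. norm (s n x) \<le> B * indicator (cball (0::'a) (R + norm e)) x" for n
      using bound by (intro always_eventually allI)
    show "AE x in lborel. (\<lambda>n. s n x) \<longlonglongrightarrow> w' x e"
      using lim by (intro always_eventually allI)
  qed simp_all
  then show ?thesis using ints by (simp add: LIMSEQ_const_iff)
qed

lemma integral_divergence_eq_0:
  fixes W :: "'a::euclidean_space \<Rightarrow> 'a"
  assumes W: "\<And>x. (W has_derivative W' x) (at x)"
    and cont: "\<And>b. continuous_on UNIV (\<lambda>x. W' x b)"
    and K: "compact K" "\<And>x. x \<notin> K \<Longrightarrow> W x = 0"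
  shows "(LINT x|lborel. (\<Sum>b\<in>Basis. W' x b \<bullet> b)) = 0"
    and "integrable lborel (\<lambda>x. \<Sum>b\<in>Basis. W' x b \<bullet> b)"
proof -
  have d: "((\<lambda>x. W x \<bullet> b) has_derivative (\<lambda>v. W' x v \<bullet> b)) (at x)" for x b
    by (rule has_derivative_inner_left[OF W])
  have c: "continuous_on UNIV (\<lambda>x. W' x v \<bullet> b)" for v b
    by (intro continuous_intros cont)
  have int: "integrable lborel (\<lambda>x. W' x v \<bullet> b)" for v b
  proof (rule integrable_lborel_compact_support[OF K(1)])
    show "continuous_on K (\<lambda>x. W' x v \<bullet> b)" using c by (rule continuous_on_subset) simp
    show "W' x v \<bullet> b = 0" if "x \<notin> K" for x
      by (rule has_derivative_zero_outside_support[OF d compact_imp_closed[OF K(1)] _ that])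
         (simp add: K(2))
  qed
  have "(LINT x|lborel. W' x b \<bullet> b) = 0" for b
    by (rule integral_directional_derivative_eq_0[OF d c K(1)]) (simp add: K(2))
  then show "(LINT x|lborel. (\<Sum>b\<in>Basis. W' x b \<bullet> b)) = 0"
    using int by (simp add: Bochner_Integration.integral_sum)
  show "integrable lborel (\<lambda>x. \<Sum>b\<in>Basis. W' x b \<bullet> b)"
    by (intro Bochner_Integration.integrable_sum int)
qed

text \<open>The divergence theorem for the product of \<phi> and \<open>Y\<close>. As \<phi>
  vanishes off \<open>K\<close>, the product is continuously differentiable everywhere although
  \<open>Y\<close> is controlled only on a neighbourhood \<open>U\<close> of \<open>K\<close>. This
  admits fields that are singular away from \<open>K\<close>, such as one involving
  \<open>1 / D\<close>.\<close>

lemma integral_divergence_mult_eq_0: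
  fixes Y :: "'a::euclidean_space \<Rightarrow> 'a"
  assumes \<phi>: "\<And>x. (\<phi> has_derivative (\<lambda>v. g x \<bullet> v)) (at x)" "continuous_on UNIV g"
    and K: "compact K" "\<And>x. x \<notin> K \<Longrightarrow> \<phi> x = 0"
    and U: "open U" "K \<subseteq> U"
    and Y: "\<And>x. x \<in> U \<Longrightarrow> (Y has_derivative Y' x) (at x)" "\<And>b. continuous_on U (\<lambda>x. Y' x b)"
  shows "(LINT x|lborel. g x \<bullet> Y x + \<phi> x * (\<Sum>b\<in>Basis. Y' x b \<bullet> b)) = 0"
    and "integrable lborel (\<lambda>x. g x \<bullet> Y x + \<phi> x * (\<Sum>b\<in>Basis. Y' x b \<bullet> b))"
proof -
  define W where "W x = \<phi> x *\<^sub>R Y x" for x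
  define W' where "W' x v = (g x \<bullet> v) *\<^sub>R Y x + \<phi> x *\<^sub>R Y' x v" for x v
  have g0: "g x = 0" if "x \<notin> K" for x
    using has_derivative_zero_outside_support[OF \<phi>(1) compact_imp_closed[OF K(1)] K(2) that, of "g x"]
    by simp
  have oK: "open (- K)" using K(1) by (simp add: compact_imp_closed open_Compl)
  have W: "(W has_derivative W' x) (at x)" for x
  proof (cases "x \<in> K")
    case True
    then have "x \<in> U" using U by auto
    show ?thesis
      unfolding W_def[abs_def] W'_def[abs_def]
      using has_derivative_scaleR[OF \<phi>(1) Y(1)[OF \<open>x \<in> U\<close>]] by (simp add: add.commute)
  next
    case False
    have "W' x = (\<lambda>v. 0)" using False by (simp add: W'_def[abs_def] g0 K(2))
    moreover have "((\<lambda>x. 0) has_derivative (\<lambda>v. 0)) (at x)" by simp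
    ultimately show ?thesis
      using has_derivative_transform_within_open[of "\<lambda>x. 0" "\<lambda>v. 0" x UNIV "- K" W] oK False K(2)
      by (simp add: W_def)
  qed
  have cont: "continuous_on UNIV (\<lambda>x. W' x b)" for b
  proof -
    have "continuous_on U Y"
      by (intro continuous_at_imp_continuous_on ballI has_derivative_continuous[OF Y(1)])
    moreover have "continuous_on U g" using \<phi>(2) continuous_on_subset by blast
    moreover have "continuous_on U \<phi>"
      by (intro continuous_at_imp_continuous_on ballI has_derivative_continuous[OF \<phi>(1)])
    ultimately have "continuous_on U (\<lambda>x. W' x b)"
      unfolding W'_def by (intro continuous_intros Y(2))
    moreover have "continuous_on (- K) (\<lambda>x. W' x b)"
      by (rule continuous_on_eq[of _ "\<lambda>x. 0"]) (auto simp: W'_def g0 K(2))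
    \<comment> \<open>Continuity is glued from two open sets that cover the space.\<close>
    ultimately have "continuous_on (U \<union> - K) (\<lambda>x. W' x b)"
      using U(1) oK by (intro continuous_on_open_Un)
    moreover have "U \<union> - K = UNIV" using U(2) by auto
    ultimately show ?thesis by simp
  qed
  have W0: "W x = 0" if "x \<notin> K" for x using K(2)[OF that] by (simp add: W_def)
  have eq: "(\<Sum>b\<in>Basis. W' x b \<bullet> b) = g x \<bullet> Y x + \<phi> x * (\<Sum>b\<in>Basis. Y' x b \<bullet> b)" for x
    by (simp add: W'_def inner_add_left sum.distrib sum_distrib_left euclidean_inner[of "g x" "Y x"])
  show "(LINT x|lborel. g x \<bullet> Y x + \<phi> x * (\<Sum>b\<in>Basis. Y' x b \<bullet> b)) = 0"
    using integral_divergence_eq_0(1)[OF W cont K(1) W0] by (simp add: eq)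
  show "integrable lborel (\<lambda>x. g x \<bullet> Y x + \<phi> x * (\<Sum>b\<in>Basis. Y' x b \<bullet> b))"
    using integral_divergence_eq_0(2)[OF W cont K(1) W0] by (simp add: eq)
qed

subsection \<open>Smooth concave approximation of the distance function\<close>

text \<open>The hyperplane is taken through a boundary point \<open>z\<close> nearest to
  \<open>y\<close>, with \<open>n\<close> pointing inwards. Going from \<open>x\<close> against
  \<open>n\<close> by less than the distance of \<open>x\<close> to the boundary stays inside
  \<Omega>, hence on the inner side of the hyperplane; at \<open>y\<close> the reverse bound is
  Cauchy-Schwarz.\<close>

lemma ex_supporting_affine_infdist:
  fixes \<Omega> :: "'a::euclidean_space set"
  assumes \<Omega>: "open \<Omega>" "convex \<Omega>" "bounded \<Omega>" and y: "y \<in> \<Omega>"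
  shows "\<exists>n b. norm n = 1 \<and> (\<forall>x\<in>\<Omega>. infdist x (frontier \<Omega>) \<le> n \<bullet> x - b) \<and>
    n \<bullet> y - b \<le> infdist y (frontier \<Omega>)"
proof -
  have "frontier \<Omega> \<noteq> {}"
    using \<Omega> y by (auto simp: frontier_eq_empty)
  then obtain z where z: "z \<in> frontier \<Omega>" "infdist y (frontier \<Omega>) = dist y z"
    using infdist_attains_inf[OF frontier_closed] by metis
  have "z \<notin> \<Omega>" using z(1) \<Omega>(1) by (simp add: frontier_def interior_open)
  obtain a c where a: "a \<noteq> 0" "a \<bullet> z \<le> c" "\<And>x. x \<in> \<Omega> \<Longrightarrow> c \<le> a \<bullet> x"
    using separating_hyperplane_sets[of "{z}" \<Omega>] \<Omega> y \<open>z \<notin> \<Omega>\<close> by auto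
  define n where "n = a /\<^sub>R norm a"
  have n: "norm n = 1" using a(1) by (simp add: n_def)
  have ge: "n \<bullet> z \<le> n \<bullet> x" if "x \<in> \<Omega>" for x
    using a(2) a(3)[OF that] by (auto simp: n_def intro!: mult_left_mono)
  have "infdist x (frontier \<Omega>) \<le> n \<bullet> x - n \<bullet> z" if x: "x \<in> \<Omega>" for x
  proof (rule field_le_epsilon)
    fix e :: real assume "e > 0"
    define r where "r = infdist x (frontier \<Omega>) - e"
    show "infdist x (frontier \<Omega>) \<le> n \<bullet> x - n \<bullet> z + e"
    proof (cases "r \<ge> 0")
      case True
      \<comment> \<open>A ball of radius smaller than the distance misses the frontier, and a
        connected set meeting \<Omega> but not its frontier lies in \<Omega>.\<close>
      have "cball x r \<inter> frontier \<Omega> = {}"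
        using infdist_le[of _ "frontier \<Omega>" x] \<open>e > 0\<close> by (fastforce simp: r_def)
      moreover have "x \<in> cball x r" using True by simp
      ultimately have "cball x r \<subseteq> \<Omega>"
        using connected_Int_frontier[of "cball x r" \<Omega>] x by (metis Diff_eq_empty_iff Int_iff connected_cball empty_iff)
      moreover have "x - r *\<^sub>R n \<in> cball x r" using n True by (simp add: dist_norm)
      ultimately have "n \<bullet> z \<le> n \<bullet> (x - r *\<^sub>R n)" using ge by blast
      moreover have "n \<bullet> n = 1" using n by (simp add: norm_eq_1)
      ultimately show ?thesis by (simp add: r_def inner_diff_right)
    next
      case False
      then show ?thesis using ge[OF x] by (simp add: r_def)
    qed
  qed
  moreover have "n \<bullet> y - n \<bullet> z \<le> infdist y (frontier \<Omega>)"
    using norm_cauchy_schwarz[of n "y - z"] n z(2) by (simp add: inner_diff_right dist_norm)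
  ultimately show ?thesis using n by blast
qed

text \<open>Compactness: the affine function chosen for \<open>y\<close> exceeds the distance by
  less than \<eta> on an open neighbourhood of \<open>y\<close>, and finitely many of these
  neighbourhoods cover \<open>K\<close>.\<close>

lemma ex_finite_supporting_affine:
  fixes \<Omega> :: "'a::euclidean_space set"
  assumes \<Omega>: "open \<Omega>" "convex \<Omega>" "bounded \<Omega>" and K: "compact K" "K \<subseteq> \<Omega>" "K \<noteq> {}" and "0 < \<eta>"
  shows "\<exists>J :: ('a \<times> real) set. finite J \<and> J \<noteq> {} \<and>
    (\<forall>j\<in>J. norm (fst j) = 1 \<and> (\<forall>x\<in>\<Omega>. infdist x (frontier \<Omega>) \<le> fst j \<bullet> x - snd j)) \<and>
    (\<forall>y\<in>K. \<exists>j\<in>J. fst j \<bullet> y - snd j < infdist y (frontier \<Omega>) + \<eta>)"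
proof -
  let ?d = "\<lambda>x. infdist x (frontier \<Omega>)"
  have "\<forall>y\<in>K. \<exists>j. norm (fst j) = 1 \<and> (\<forall>x\<in>\<Omega>. ?d x \<le> fst j \<bullet> x - snd j) \<and> fst j \<bullet> y - snd j \<le> ?d y"
    using ex_supporting_affine_infdist[OF \<Omega>] K(2) by (metis fst_conv snd_conv subsetD)
  then obtain j where j: "\<And>y. y \<in> K \<Longrightarrow> norm (fst (j y)) = 1"
      "\<And>y x. y \<in> K \<Longrightarrow> x \<in> \<Omega> \<Longrightarrow> ?d x \<le> fst (j y) \<bullet> x - snd (j y)"
      "\<And>y. y \<in> K \<Longrightarrow> fst (j y) \<bullet> y - snd (j y) \<le> ?d y"
    by metis
  define V where "V y = {x. fst (j y) \<bullet> x - snd (j y) < ?d x + \<eta>}" for y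
  have "open (V y)" for y
    unfolding V_def by (intro open_Collect_less continuous_intros)
  moreover have "K \<subseteq> (\<Union>y\<in>K. V y)"
    using j(3) \<open>0 < \<eta>\<close> by (fastforce simp: V_def)
  ultimately obtain C where C: "C \<subseteq> K" "finite C" "K \<subseteq> (\<Union>y\<in>C. V y)"
    using compactE_image[OF K(1), of K V] by metis
  have "C \<noteq> {}" using C(3) K(3) by auto
  then show ?thesis
    using C j by (intro exI[of _ "j ` C"]) (auto simp: V_def subset_iff)
qed

section \<open>The soft minimum of finitely many affine functions: derivatives, bounds and
  concavity\<close>

text \<open>A pair \<open>j\<close> stands for the affine function with normal \<open>fst j\<close>
  and offset \<open>snd j\<close>. These are Gibbs weights at temperature \<epsilon>, which favour
  the affine functions that are smallest at \<open>x\<close>.\<close>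

definition softmin_weight :: "('a::euclidean_space \<times> real) set \<Rightarrow> real \<Rightarrow> 'a \<times> real \<Rightarrow> 'a \<Rightarrow> real"
  where "softmin_weight J \<epsilon> j x =
    exp (- (fst j \<bullet> x - snd j) / \<epsilon>) / (\<Sum>i\<in>J. exp (- (fst i \<bullet> x - snd i) / \<epsilon>))"

definition softmin :: "('a::euclidean_space \<times> real) set \<Rightarrow> real \<Rightarrow> 'a \<Rightarrow> real"
  where "softmin J \<epsilon> x = - \<epsilon> * ln (\<Sum>j\<in>J. exp (- (fst j \<bullet> x - snd j) / \<epsilon>))"

definition softmin_grad :: "('a::euclidean_space \<times> real) set \<Rightarrow> real \<Rightarrow> 'a \<Rightarrow> 'a"
  where "softmin_grad J \<epsilon> x = (\<Sum>j\<in>J. softmin_weight J \<epsilon> j x *\<^sub>R fst j)"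

text \<open>The logarithmic derivative of the weight of \<open>j\<close> in direction
  \<open>v\<close> is \<open>((softmin_grad J \<epsilon> x - fst j) \<bullet> v) /
  \<epsilon>\<close>, while the normals are constant.\<close>

definition softmin_hess :: "('a::euclidean_space \<times> real) set \<Rightarrow> real \<Rightarrow> 'a \<Rightarrow> 'a \<Rightarrow> 'a"
  where "softmin_hess J \<epsilon> x v =
    (\<Sum>j\<in>J. (softmin_weight J \<epsilon> j x * ((softmin_grad J \<epsilon> x - fst j) \<bullet> v) / \<epsilon>) *\<^sub>R fst j)"

context
  fixes J :: "('a::euclidean_space \<times> real) set" and \<epsilon> :: real
  assumes J: "finite J" "J \<noteq> {}" and eps: "0 < \<epsilon>"
begin

lemma softmin_sum_pos: "0 < (\<Sum>j\<in>J. exp (- (fst j \<bullet> x - snd j) / \<epsilon>))"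
  using J by (intro sum_pos) auto

lemma softmin_weight_nonneg: "0 \<le> softmin_weight J \<epsilon> j x"
  using softmin_sum_pos[of x] by (auto simp: softmin_weight_def)

lemma sum_softmin_weight: "(\<Sum>j\<in>J. softmin_weight J \<epsilon> j x) = 1"
  using softmin_sum_pos[of x] by (simp add: softmin_weight_def flip: sum_divide_distrib)

lemma inner_softmin_grad: "softmin_grad J \<epsilon> x \<bullet> v = (\<Sum>j\<in>J. softmin_weight J \<epsilon> j x * (fst j \<bullet> v))"
  by (simp add: softmin_grad_def inner_sum_left)

lemma softmin_has_derivative:
  "(softmin J \<epsilon> has_derivative (\<lambda>v. softmin_grad J \<epsilon> x \<bullet> v)) (at x)"
proof -
  have "(softmin J \<epsilon> has_derivative (\<lambda>v. - \<epsilon> * ((\<Sum>j\<in>J. exp (- (fst j \<bullet> x - snd j) / \<epsilon>) * (- (fst j \<bullet> v) / \<epsilon>))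
      / (\<Sum>j\<in>J. exp (- (fst j \<bullet> x - snd j) / \<epsilon>))))) (at x)"
    unfolding softmin_def[abs_def] using softmin_sum_pos[of x] eps
    by (auto intro!: derivative_eq_intros simp: divide_inverse mult_ac)
  also have "(\<lambda>v. - \<epsilon> * ((\<Sum>j\<in>J. exp (- (fst j \<bullet> x - snd j) / \<epsilon>) * (- (fst j \<bullet> v) / \<epsilon>))
      / (\<Sum>j\<in>J. exp (- (fst j \<bullet> x - snd j) / \<epsilon>)))) = (\<lambda>v. softmin_grad J \<epsilon> x \<bullet> v)"
  proof
    fix v
    define e where "e j = exp (- (fst j \<bullet> x - snd j) / \<epsilon>)" for j :: "'a \<times> real"
    define S where "S = (\<Sum>j\<in>J. e j)"
    have "- \<epsilon> * ((\<Sum>j\<in>J. e j * (- (fst j \<bullet> v) / \<epsilon>)) / S) = (\<Sum>j\<in>J. e j / S * (fst j \<bullet> v))"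
      using eps by (simp add: sum_distrib_left sum_divide_distrib)
    then show "- \<epsilon> * ((\<Sum>j\<in>J. exp (- (fst j \<bullet> x - snd j) / \<epsilon>) * (- (fst j \<bullet> v) / \<epsilon>))
        / (\<Sum>j\<in>J. exp (- (fst j \<bullet> x - snd j) / \<epsilon>))) = softmin_grad J \<epsilon> x \<bullet> v"
      unfolding inner_softmin_grad softmin_weight_def S_def e_def .
  qed
  finally show ?thesis .
qed

lemma softmin_weight_has_derivative:
  "(softmin_weight J \<epsilon> j has_derivative
    (\<lambda>v. softmin_weight J \<epsilon> j x * ((softmin_grad J \<epsilon> x - fst j) \<bullet> v) / \<epsilon>)) (at x)"
proof -
  define S where "S x = (\<Sum>j\<in>J. exp (- (fst j \<bullet> x - snd j) / \<epsilon>))" for x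
  have S0: "S x \<noteq> 0" using softmin_sum_pos[of x] by (simp add: S_def)
  have e: "((\<lambda>x. exp (- (fst j \<bullet> x - snd j) / \<epsilon>)) has_derivative
      (\<lambda>v. exp (- (fst j \<bullet> x - snd j) / \<epsilon>) * (- (fst j \<bullet> v) / \<epsilon>))) (at x)" for j :: "'a \<times> real"
    using eps by (auto intro!: derivative_eq_intros)
  have dS: "(S has_derivative (\<lambda>v. S x * (- (softmin_grad J \<epsilon> x \<bullet> v) / \<epsilon>))) (at x)"
  proof -
    have "(S has_derivative (\<lambda>v. \<Sum>j\<in>J. exp (- (fst j \<bullet> x - snd j) / \<epsilon>) * (- (fst j \<bullet> v) / \<epsilon>))) (at x)"
      unfolding S_def[abs_def] by (intro has_derivative_sum e)
    also have "(\<lambda>v. \<Sum>j\<in>J. exp (- (fst j \<bullet> x - snd j) / \<epsilon>) * (- (fst j \<bullet> v) / \<epsilon>)) =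
        (\<lambda>v. S x * (- (softmin_grad J \<epsilon> x \<bullet> v) / \<epsilon>))"
    proof
      fix v
      have "S x * (- (softmin_grad J \<epsilon> x \<bullet> v) / \<epsilon>)
          = (\<Sum>j\<in>J. S x * (exp (- (fst j \<bullet> x - snd j) / \<epsilon>) / S x) * (- (fst j \<bullet> v) / \<epsilon>))"
        unfolding inner_softmin_grad softmin_weight_def S_def[symmetric]
        using S0 by (simp add: sum_distrib_left sum_divide_distrib sum_negf)
      then show "(\<Sum>j\<in>J. exp (- (fst j \<bullet> x - snd j) / \<epsilon>) * (- (fst j \<bullet> v) / \<epsilon>)) =
          S x * (- (softmin_grad J \<epsilon> x \<bullet> v) / \<epsilon>)"
        using S0 by simp
    qed
    finally show ?thesis .
  qed
  have "((\<lambda>x. exp (- (fst j \<bullet> x - snd j) / \<epsilon>) / S x) has_derivative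
      (\<lambda>v. - exp (- (fst j \<bullet> x - snd j) / \<epsilon>) * (inverse (S x) * (S x * (- (softmin_grad J \<epsilon> x \<bullet> v) / \<epsilon>)) * inverse (S x))
        + exp (- (fst j \<bullet> x - snd j) / \<epsilon>) * (- (fst j \<bullet> v) / \<epsilon>) / S x)) (at x)"
    by (rule has_derivative_divide[OF e dS S0])
  also have "(\<lambda>x. exp (- (fst j \<bullet> x - snd j) / \<epsilon>) / S x) = softmin_weight J \<epsilon> j"
    by (simp add: softmin_weight_def S_def fun_eq_iff)
  also have "(\<lambda>v. - exp (- (fst j \<bullet> x - snd j) / \<epsilon>) * (inverse (S x) * (S x * (- (softmin_grad J \<epsilon> x \<bullet> v) / \<epsilon>)) * inverse (S x))
        + exp (- (fst j \<bullet> x - snd j) / \<epsilon>) * (- (fst j \<bullet> v) / \<epsilon>) / S x)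
      = (\<lambda>v. (exp (- (fst j \<bullet> x - snd j) / \<epsilon>) / S x) * ((softmin_grad J \<epsilon> x - fst j) \<bullet> v) / \<epsilon>)"
    using S0 eps by (simp add: fun_eq_iff field_simps inner_diff_left)
  also have "exp (- (fst j \<bullet> x - snd j) / \<epsilon>) / S x = softmin_weight J \<epsilon> j x"
    by (simp add: softmin_weight_def S_def)
  finally show ?thesis .
qed

lemma softmin_grad_has_derivative:
  "(softmin_grad J \<epsilon> has_derivative softmin_hess J \<epsilon> x) (at x)"
  unfolding softmin_grad_def[abs_def] softmin_hess_def[abs_def, unfolded softmin_grad_def[abs_def]]
  by (intro has_derivative_sum has_derivative_scaleR_left
      softmin_weight_has_derivative[unfolded softmin_grad_def[abs_def]])

lemma continuous_softmin_weight: "continuous_on UNIV (softmin_weight J \<epsilon> j)"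
  by (intro continuous_at_imp_continuous_on ballI has_derivative_continuous[OF softmin_weight_has_derivative])

lemma continuous_softmin_grad: "continuous_on UNIV (softmin_grad J \<epsilon>)"
  by (intro continuous_at_imp_continuous_on ballI has_derivative_continuous[OF softmin_grad_has_derivative])

lemma continuous_softmin_hess: "continuous_on UNIV (\<lambda>x. softmin_hess J \<epsilon> x v)"
  unfolding softmin_hess_def divide_inverse
  by (intro continuous_intros continuous_softmin_grad continuous_softmin_weight)

lemma norm_softmin_grad_le:
  assumes "\<And>j. j \<in> J \<Longrightarrow> norm (fst j) = 1"
  shows "norm (softmin_grad J \<epsilon> x) \<le> 1"
proof -
  have "norm (softmin_grad J \<epsilon> x) \<le> (\<Sum>j\<in>J. norm (softmin_weight J \<epsilon> j x *\<^sub>R fst j))"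
    unfolding softmin_grad_def by (rule norm_sum)
  also have "\<dots> = (\<Sum>j\<in>J. softmin_weight J \<epsilon> j x)"
    using assms softmin_weight_nonneg by (intro sum.cong) auto
  finally show ?thesis by (simp add: sum_softmin_weight)
qed

text \<open>Up to the factor \<^term>\<open>- 1 / \<epsilon>\<close> this is the variance of the unit normals. It is what makes the
  smoothing harmless where the gradient is shorter than 1.\<close>

lemma trace_softmin_hess:
  assumes "\<And>j. j \<in> J \<Longrightarrow> norm (fst j) = 1"
  shows "(\<Sum>b\<in>Basis. softmin_hess J \<epsilon> x b \<bullet> b) = - (1 - (norm (softmin_grad J \<epsilon> x))\<^sup>2) / \<epsilon>"
proof -
  let ?a = "softmin_grad J \<epsilon> x" and ?p = "\<lambda>j. softmin_weight J \<epsilon> j x"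
  have "(\<Sum>b\<in>Basis. softmin_hess J \<epsilon> x b \<bullet> b)
      = (\<Sum>b\<in>Basis. \<Sum>j\<in>J. ?p j / \<epsilon> * (((?a - fst j) \<bullet> b) * (fst j \<bullet> b)))"
    by (simp add: softmin_hess_def inner_sum_left mult_ac)
  also have "\<dots> = (\<Sum>j\<in>J. ?p j / \<epsilon> * (\<Sum>b\<in>Basis. ((?a - fst j) \<bullet> b) * (fst j \<bullet> b)))"
    by (subst sum.swap) (simp add: sum_distrib_left)
  also have "\<dots> = (\<Sum>j\<in>J. ?p j / \<epsilon> * ((?a - fst j) \<bullet> fst j))"
    by (simp only: euclidean_inner[symmetric])
  also have "\<dots> = (\<Sum>j\<in>J. ?p j * (fst j \<bullet> ?a) / \<epsilon> - ?p j / \<epsilon>)"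
  proof (intro sum.cong refl)
    fix j assume "j \<in> J"
    then have "fst j \<bullet> fst j = 1" using assms by (simp add: norm_eq_1)
    then show "?p j / \<epsilon> * ((?a - fst j) \<bullet> fst j) = ?p j * (fst j \<bullet> ?a) / \<epsilon> - ?p j / \<epsilon>"
      by (simp add: inner_diff_left inner_commute algebra_simps)
  qed
  also have "\<dots> = (?a \<bullet> ?a - 1) / \<epsilon>"
    by (simp add: sum_subtractf inner_softmin_grad[of x ?a] sum_softmin_weight diff_divide_distrib
        flip: sum_divide_distrib)
  finally show ?thesis by (simp add: power2_norm_eq_inner diff_divide_distrib)
qed

lemma softmin_le:
  assumes "j \<in> J"
  shows "softmin J \<epsilon> x \<le> fst j \<bullet> x - snd j"
proof -
  have "exp (- (fst j \<bullet> x - snd j) / \<epsilon>) \<le> (\<Sum>j\<in>J. exp (- (fst j \<bullet> x - snd j) / \<epsilon>))"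
    using J assms by (intro member_le_sum) auto
  then have "- (fst j \<bullet> x - snd j) / \<epsilon> \<le> ln (\<Sum>j\<in>J. exp (- (fst j \<bullet> x - snd j) / \<epsilon>))"
    using softmin_sum_pos[of x] by (simp add: ln_ge_iff)
  then show ?thesis using eps by (simp add: softmin_def field_simps)
qed

text \<open>Each of the \<open>card J\<close> exponentials is at most
  \<open>exp (- m / \<epsilon>)\<close>; their number costs the logarithmic error.\<close>

lemma softmin_ge:
  assumes "\<And>j. j \<in> J \<Longrightarrow> m \<le> fst j \<bullet> x - snd j"
  shows "m - \<epsilon> * ln (card J) \<le> softmin J \<epsilon> x"
proof -
  have "(\<Sum>j\<in>J. exp (- (fst j \<bullet> x - snd j) / \<epsilon>)) \<le> (\<Sum>j\<in>J. exp (- m / \<epsilon>))"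
  proof (intro sum_mono)
    fix j assume "j \<in> J"
    then have "- (fst j \<bullet> x - snd j) / \<epsilon> \<le> - m / \<epsilon>"
      using assms eps by (intro divide_right_mono) (auto simp: algebra_simps)
    then show "exp (- (fst j \<bullet> x - snd j) / \<epsilon>) \<le> exp (- m / \<epsilon>)" by simp
  qed
  then have "(\<Sum>j\<in>J. exp (- (fst j \<bullet> x - snd j) / \<epsilon>)) \<le> card J * exp (- m / \<epsilon>)" by simp
  then have "ln (\<Sum>j\<in>J. exp (- (fst j \<bullet> x - snd j) / \<epsilon>)) \<le> ln (card J * exp (- m / \<epsilon>))"
    using softmin_sum_pos[of x] by (intro ln_mono) auto
  also have "\<dots> = ln (card J) - m / \<epsilon>"
    using J by (subst ln_mult) (auto simp: card_gt_0_iff)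
  finally have "\<epsilon> * ln (\<Sum>j\<in>J. exp (- (fst j \<bullet> x - snd j) / \<epsilon>)) \<le> \<epsilon> * (ln (card J) - m / \<epsilon>)"
    using eps by (intro mult_left_mono) auto
  then show ?thesis using eps by (simp add: softmin_def right_diff_distrib)
qed

text \<open>Jensen's inequality for \<open>exp\<close> with the Gibbs weights at \<open>x\<close>:
  the weighted mean of the exponentials of the increments is the quotient of the two sums at
  \<open>z\<close> and at \<open>x\<close>.\<close>

lemma softmin_concave:
  "softmin J \<epsilon> z \<le> softmin J \<epsilon> x + softmin_grad J \<epsilon> x \<bullet> (z - x)"
proof -
  let ?e = "\<lambda>j x. exp (- (fst j \<bullet> x - snd j) / \<epsilon>)" and ?p = "\<lambda>j. softmin_weight J \<epsilon> j x"
  let ?S = "\<lambda>x. \<Sum>j\<in>J. ?e j x"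
  have "exp (\<Sum>j\<in>J. ?p j *\<^sub>R (- (fst j \<bullet> (z - x)) / \<epsilon>)) \<le> (\<Sum>j\<in>J. ?p j * exp (- (fst j \<bullet> (z - x)) / \<epsilon>))"
    by (intro convex_on_sum[OF J exp_convex])
       (auto simp: sum_softmin_weight softmin_weight_nonneg)
  also have "(\<Sum>j\<in>J. ?p j *\<^sub>R (- (fst j \<bullet> (z - x)) / \<epsilon>)) = - (softmin_grad J \<epsilon> x \<bullet> (z - x)) / \<epsilon>"
    by (simp add: inner_softmin_grad sum_negf sum_divide_distrib)
  also have "(\<Sum>j\<in>J. ?p j * exp (- (fst j \<bullet> (z - x)) / \<epsilon>)) = ?S z / ?S x"
  proof -
    have "?p j * exp (- (fst j \<bullet> (z - x)) / \<epsilon>) = ?e j z / ?S x" for j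
    proof -
      have "- (fst j \<bullet> x - snd j) / \<epsilon> + - (fst j \<bullet> (z - x)) / \<epsilon> = - (fst j \<bullet> z - snd j) / \<epsilon>"
        by (simp add: inner_diff_right flip: add_divide_distrib)
      then have "?e j x * exp (- (fst j \<bullet> (z - x)) / \<epsilon>) = ?e j z"
        by (simp only: exp_add[symmetric])
      then show ?thesis unfolding softmin_weight_def times_divide_eq_left by (rule arg_cong)
    qed
    then show ?thesis by (simp only: sum_divide_distrib)
  qed
  finally have "- (softmin_grad J \<epsilon> x \<bullet> (z - x)) / \<epsilon> \<le> ln (?S z / ?S x)"
    using softmin_sum_pos by (simp add: ln_ge_iff)
  also have "\<dots> = ln (?S z) - ln (?S x)"
    using softmin_sum_pos[of z] softmin_sum_pos[of x] by (simp add: ln_div)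
  finally show ?thesis using eps by (simp add: softmin_def field_simps)
qed

end

text \<open>A soft minimum of supporting affine functions, lowered by a constant. All error terms
  are measured against \<delta>, the least distance of a point of \<open>K\<close> to the
  boundary.\<close>

lemma ex_smooth_concave_distance:
  fixes \<Omega> :: "'a::euclidean_space set"
  assumes \<Omega>: "open \<Omega>" "convex \<Omega>" "bounded \<Omega>" and K: "compact K" "K \<subseteq> \<Omega>" "K \<noteq> {}"
  obtains D A A' and \<epsilon> :: real where
    "\<And>x. (D has_derivative (\<lambda>v. A x \<bullet> v)) (at x)"
    "\<And>x. (A has_derivative A' x) (at x)"
    "\<And>v. continuous_on UNIV (\<lambda>x. A' x v)"
    "\<And>x. norm (A x) \<le> 1"
    "\<And>x z. D z \<le> D x + A x \<bullet> (z - x)"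
    "\<And>x. (\<Sum>b\<in>Basis. A' x b \<bullet> b) = - (1 - (norm (A x))\<^sup>2) / \<epsilon>"
    "0 < \<epsilon>" "\<And>x. x \<in> K \<Longrightarrow> 2 * \<epsilon> \<le> D x"
    "\<And>x. x \<in> K \<Longrightarrow> infdist x (frontier \<Omega>) / 2 \<le> D x"
    "\<And>x. x \<in> K \<Longrightarrow> D x \<le> infdist x (frontier \<Omega>)"
proof -
  let ?d = "\<lambda>x. infdist x (frontier \<Omega>)"
  have "frontier \<Omega> \<noteq> {}"
    using \<Omega> K by (auto simp: frontier_eq_empty)
  moreover have "frontier \<Omega> \<inter> \<Omega> = {}" using \<Omega>(1) by (auto simp: frontier_def interior_open)
  ultimately have d_pos: "0 < ?d x" if "x \<in> K" for x
    using that K(2) by (auto intro!: infdist_pos_not_in_closed)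
  have "continuous_on K ?d" by (intro continuous_intros)
  then obtain x1 where x1: "x1 \<in> K" "\<And>x. x \<in> K \<Longrightarrow> ?d x1 \<le> ?d x"
    using continuous_attains_inf[OF K(1) K(3)] by blast
  define \<delta> where "\<delta> = ?d x1"
  have \<delta>: "0 < \<delta>" "\<And>x. x \<in> K \<Longrightarrow> \<delta> \<le> ?d x"
    using x1 d_pos by (auto simp: \<delta>_def)
  have "0 < \<delta> / 4" using \<delta>(1) by simp
  from ex_finite_supporting_affine[OF \<Omega> K this] obtain J :: "('a \<times> real) set" where "finite J" "J \<noteq> {}"
    "\<forall>j\<in>J. norm (fst j) = 1 \<and> (\<forall>x\<in>\<Omega>. ?d x \<le> fst j \<bullet> x - snd j)"
    "\<forall>y\<in>K. \<exists>j\<in>J. fst j \<bullet> y - snd j < ?d y + \<delta> / 4"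
    by blast
  then have J: "finite J" "J \<noteq> {}"
    "\<And>j. j \<in> J \<Longrightarrow> norm (fst j) = 1"
    "\<And>j x. j \<in> J \<Longrightarrow> x \<in> \<Omega> \<Longrightarrow> ?d x \<le> fst j \<bullet> x - snd j"
    "\<And>y. y \<in> K \<Longrightarrow> \<exists>j\<in>J. fst j \<bullet> y - snd j < ?d y + \<delta> / 4"
    by blast+
  have card: "1 \<le> card J" using J(1,2) by (simp add: Suc_le_eq card_gt_0_iff)
  \<comment> \<open>Makes both \<epsilon> and the soft minimum error
    \<open>\<epsilon> * ln (card J)\<close> at most \<open>\<delta> / 4\<close>.\<close>
  define \<epsilon> where "\<epsilon> = \<delta> / 4 / (1 + ln (card J))"
  have l: "0 \<le> ln (card J)" using card by simp
  have \<epsilon>: "0 < \<epsilon>" "\<epsilon> \<le> \<delta> / 4" "\<epsilon> * ln (card J) \<le> \<delta> / 4"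
    using l \<delta>(1) by (auto simp: \<epsilon>_def field_simps add_nonneg_pos)
  \<comment> \<open>The shift removes the excess \<open>\<delta> / 4\<close> of the affine functions
    over the distance, which gives the upper bound for \<open>D\<close> on \<open>K\<close>.\<close>
  define D where "D x = softmin J \<epsilon> x - \<delta> / 4" for x
  note sm = J(1,2) \<epsilon>(1)
  have low: "?d x - \<delta> / 2 \<le> D x" if "x \<in> K" for x
    using softmin_ge[OF sm, of "?d x" x] J(4) that K(2) \<epsilon>(3) by (force simp: D_def)
  show thesis
  proof (rule that[of D "softmin_grad J \<epsilon>" "softmin_hess J \<epsilon>" \<epsilon>])
    show "(D has_derivative (\<lambda>v. softmin_grad J \<epsilon> x \<bullet> v)) (at x)" for x
      unfolding D_def[abs_def] using has_derivative_diff[OF softmin_has_derivative[OF sm] has_derivative_const]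
      by simp
    show "D z \<le> D x + softmin_grad J \<epsilon> x \<bullet> (z - x)" for x z
      using softmin_concave[OF sm] by (simp add: D_def)
    show "(\<Sum>b\<in>Basis. softmin_hess J \<epsilon> x b \<bullet> b) = - (1 - (norm (softmin_grad J \<epsilon> x))\<^sup>2) / \<epsilon>" for x
      by (rule trace_softmin_hess[OF sm J(3)])
    \<comment> \<open>As \<delta> is at most the distance \<open>?d x\<close>, the bound
      \<open>low\<close> yields both \<open>?d x / 2 \<le> D x\<close> and
      \<open>\<delta> / 2 \<le> D x\<close>; the latter dominates
      \<open>2 * \<epsilon>\<close>.\<close>
    show "2 * \<epsilon> \<le> D x" "?d x / 2 \<le> D x" if "x \<in> K" for x
      using low[OF that] \<delta>(2)[OF that] \<epsilon>(2) by auto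
    show "D x \<le> ?d x" if x: "x \<in> K" for x
    proof -
      obtain j where "j \<in> J" "fst j \<bullet> x - snd j < ?d x + \<delta> / 4" using J(5)[OF x] by blast
      then show ?thesis using softmin_le[OF sm, of j x] by (simp add: D_def)
    qed
  qed (use J(3) in \<open>auto intro: softmin_grad_has_derivative[OF sm] continuous_softmin_hess[OF sm]
      norm_softmin_grad_le[OF sm] \<epsilon>(1)\<close>)
qed

subsection \<open>Powers and integral inequalities\<close>

text \<open>Off 0 this is the ordinary power rule; at 0 the difference quotient is bounded by
  \<open>\<bar>h\<bar> powr (s - 1)\<close>, which tends to 0 because \<open>1 < s\<close>.\<close>

lemma abs_powr_has_real_derivative:
  fixes t s :: real
  assumes "1 < s"
  shows "((\<lambda>t. \<bar>t\<bar> powr s) has_real_derivative s * \<bar>t\<bar> powr (s - 1) * sgn t) (at t)"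
proof -
  consider "t > 0" | "t < 0" | "t = 0" by linarith
  then show ?thesis
  proof cases
    case 1
    then have "((\<lambda>t. t powr s) has_real_derivative s * t powr (s - 1)) (at t)"
      by (rule has_real_derivative_powr)
    then have "((\<lambda>t. \<bar>t\<bar> powr s) has_real_derivative s * t powr (s - 1)) (at t)"
      by (rule has_field_derivative_transform_within_open[of _ _ _ "{0<..}"]) (use 1 in auto)
    then show ?thesis using 1 by simp
  next
    case 2
    have "((\<lambda>t. t powr s) has_real_derivative s * (- t) powr (s - 1)) (at (- t))"
      using 2 by (intro has_real_derivative_powr) auto
    from DERIV_chain2[OF this DERIV_minus[OF DERIV_ident]]
    have "((\<lambda>t. (- t) powr s) has_real_derivative s * (- t) powr (s - 1) * (- 1)) (at t)" .
    then have "((\<lambda>t. \<bar>t\<bar> powr s) has_real_derivative s * (- t) powr (s - 1) * (- 1)) (at t)"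
      by (rule has_field_derivative_transform_within_open[of _ _ _ "{..<0}"]) (use 2 in auto)
    then show ?thesis using 2 by simp
  next
    case 3
    have "((\<lambda>h. \<bar>h\<bar> powr (s - 1)) \<longlongrightarrow> 0) (at 0)"
    proof -
      have "((\<lambda>h::real. \<bar>h\<bar> powr (s - 1)) \<longlongrightarrow> \<bar>0\<bar> powr (s - 1)) (at 0)"
        using assms by (intro tendsto_powr' tendsto_intros) auto
      then show ?thesis by simp
    qed
    then have "((\<lambda>h. \<bar>h\<bar> powr s / h) \<longlongrightarrow> 0) (at 0)"
    proof (rule Lim_null_comparison[rotated])
      show "\<forall>\<^sub>F h in at 0. norm (\<bar>h\<bar> powr s / h) \<le> \<bar>h\<bar> powr (s - 1)"
        by (rule always_eventually) (auto simp: powr_diff)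
    qed
    then show ?thesis using 3 assms by (simp add: DERIV_def)
  qed
qed

lemma continuous_abs_powr_sgn:
  fixes u :: "'a::t2_space \<Rightarrow> real"
  assumes "continuous_on S u" "0 < r"
  shows "continuous_on S (\<lambda>x. \<bar>u x\<bar> powr r * sgn (u x))"
proof -
  have "isCont (\<lambda>t. \<bar>t\<bar> powr r * sgn t) t" for t :: real
  proof (cases "t = 0")
    case True
    have "((\<lambda>t::real. \<bar>t\<bar> powr r) \<longlongrightarrow> \<bar>0\<bar> powr r) (at 0)"
      using assms(2) by (intro tendsto_powr' tendsto_intros) auto
    then have "((\<lambda>t::real. \<bar>t\<bar> powr r) \<longlongrightarrow> 0) (at 0)" by simp
    then have "((\<lambda>t::real. \<bar>t\<bar> powr r * sgn t) \<longlongrightarrow> 0) (at 0)"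
      by (rule Lim_null_comparison[rotated]) (auto simp: abs_mult sgn_if intro!: always_eventually)
    then show ?thesis using True by (simp add: isCont_def)
  next
    case False
    then show ?thesis by (intro continuous_intros) auto
  qed
  then have "continuous_on UNIV (\<lambda>t::real. \<bar>t\<bar> powr r * sgn t)"
    by (simp add: continuous_at_imp_continuous_on)
  from continuous_on_compose2[OF this assms(1)] show ?thesis by simp
qed

text \<open>Cauchy-Schwarz with upper bounds in place of the integrals, from the inequality between
  \<open>f x * g x\<close> and weighted squares. The weight \<open>k\<close> is the one that
  balances the two terms.\<close>

lemma integral_mult_le_sqrt:
  fixes f g :: "'a \<Rightarrow> real"
  assumes "integrable M (\<lambda>x. (f x)\<^sup>2)" "integrable M (\<lambda>x. (g x)\<^sup>2)" "integrable M (\<lambda>x. f x * g x)"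
    and "(LINT x|M. (f x)\<^sup>2) \<le> a" "(LINT x|M. (g x)\<^sup>2) \<le> b" "0 < a" "0 < b"
  shows "(LINT x|M. f x * g x) \<le> sqrt (a * b)"
proof -
  define k where "k = sqrt (b / a)"
  have k: "0 < k" "k\<^sup>2 = b / a" using assms by (auto simp: k_def)
  have "f x * g x \<le> k / 2 * (f x)\<^sup>2 + 1 / (2 * k) * (g x)\<^sup>2" for x
  proof -
    have "0 \<le> (k * f x - g x)\<^sup>2 / (2 * k)" using k by simp
    also have "\<dots> = k / 2 * (f x)\<^sup>2 + 1 / (2 * k) * (g x)\<^sup>2 - f x * g x"
      using k(1) by (simp add: power2_eq_square field_simps)
    finally show ?thesis by simp
  qed
  then have "(LINT x|M. f x * g x) \<le> (LINT x|M. k / 2 * (f x)\<^sup>2 + 1 / (2 * k) * (g x)\<^sup>2)"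
    using assms by (intro integral_mono) auto
  also have "\<dots> = k / 2 * (LINT x|M. (f x)\<^sup>2) + 1 / (2 * k) * (LINT x|M. (g x)\<^sup>2)"
    using assms by simp
  also have "\<dots> \<le> k / 2 * a + 1 / (2 * k) * b"
    using assms k by (intro add_mono mult_left_mono) auto
  also have "\<dots> = sqrt (a * b)"
  proof (rule real_sqrt_unique[symmetric])
    have b: "b = k\<^sup>2 * a" using k assms by simp
    have "k / 2 * a + 1 / (2 * k) * b = k * a" using k(1) by (simp add: b power2_eq_square)
    then show "(k / 2 * a + 1 / (2 * k) * b)\<^sup>2 = a * b" by (simp add: b power2_eq_square)
    show "0 \<le> k / 2 * a + 1 / (2 * k) * b" using k assms by simp
  qed
  finally show ?thesis .
qed

text \<open>Hoelder's inequality for Bochner integrals: both functions are normalised to integral 1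
  and Young's inequality is applied pointwise.\<close>

lemma integral_powr_mult_powr_le:
  fixes f g :: "'a \<Rightarrow> real"
  assumes "integrable M f" "integrable M g" "\<And>x. 0 \<le> f x" "\<And>x. 0 \<le> g x"
    and "0 \<le> \<alpha>" "0 \<le> \<beta>" "\<alpha> + \<beta> = 1" and pos: "0 < (LINT x|M. f x)" "0 < (LINT x|M. g x)"
  shows "(LINT x|M. f x powr \<alpha> * g x powr \<beta>) \<le> (LINT x|M. f x) powr \<alpha> * (LINT x|M. g x) powr \<beta>"
proof -
  define a b where "a = (LINT x|M. f x)" and "b = (LINT x|M. g x)"
  have ab: "0 < a" "0 < b" using pos by (auto simp: a_def b_def)
  have le: "f x powr \<alpha> * g x powr \<beta> \<le> a powr \<alpha> * b powr \<beta> * (\<alpha> / a * f x + \<beta> / b * g x)" for x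
  proof (cases "f x = 0 \<or> g x = 0")
    case True
    have "0 \<le> a powr \<alpha> * b powr \<beta> * (\<alpha> / a * f x + \<beta> / b * g x)"
      using assms(3,4)[of x] assms(5,6) ab by simp
    then show ?thesis using True by auto
  next
    case False
    then have fg: "0 < f x / a" "0 < g x / b"
      using assms(3,4)[of x] ab by auto
    have "f x powr \<alpha> * g x powr \<beta> = a powr \<alpha> * b powr \<beta> * ((f x / a) powr \<alpha> * (g x / b) powr \<beta>)"
      using ab assms(3,4)[of x] by (simp add: powr_divide)
    also have "\<dots> \<le> a powr \<alpha> * b powr \<beta> * (\<alpha> * (f x / a) + \<beta> * (g x / b))"
      using assms(5-7) fg by (intro mult_left_mono Youngs_inequality_0) auto
    finally show ?thesis by simp
  qed
  have "(LINT x|M. f x powr \<alpha> * g x powr \<beta>)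
      \<le> (LINT x|M. a powr \<alpha> * b powr \<beta> * (\<alpha> / a * f x + \<beta> / b * g x))"
    using assms(1-6) le ab
    by (intro integral_mono' mult_nonneg_nonneg add_nonneg_nonneg divide_nonneg_pos) auto
  also have "\<dots> = a powr \<alpha> * b powr \<beta> * (\<alpha> / a * a + \<beta> / b * b)"
    using assms(1,2) by (simp add: a_def b_def)
  also have "\<dots> = a powr \<alpha> * b powr \<beta>" using ab assms(7) by simp
  finally show ?thesis by (simp add: a_def b_def)
qed

subsection \<open>The improved Hardy inequality\<close>

text \<open>For the field \<open>H\<close>, equal to \<open>h\<close> times the gradient of
  \<open>D\<close>, and \<alpha> the squared norm of that gradient, the first claim says that the
  squared norm of \<open>H\<close>, its divergence, \<open>3 * c\<^sup>2\<close> and the Hardy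
  weight have sum at most 0. The expression is affine in \<alpha>, so it suffices to combine the
  bounds for \<alpha> = 1 and \<alpha> = 0.\<close>

lemma hardy_weight_inequality:
  fixes D d R \<epsilon> \<alpha> :: real
  assumes "0 < D" "D \<le> R" "D \<le> d" "0 < \<epsilon>" "2 * \<epsilon> \<le> D" "0 \<le> \<alpha>" "\<alpha> \<le> 1"
  defines "c \<equiv> 1 / (4 * R)" and "h \<equiv> 1 / (2 * D) - 1 / (4 * R)"
  shows "h\<^sup>2 * \<alpha> - \<alpha> / (2 * D\<^sup>2) - h * ((1 - \<alpha>) / \<epsilon>) + 3 * c\<^sup>2 + 1 / (4 * d\<^sup>2) \<le> 0"
    and "0 \<le> h" and "h * D \<le> 1 / 2"
proof -
  have R: "0 < R" using assms by simp
  define k where "k = 1 / D"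
  have k: "0 < k" "4 * c \<le> k" "0 < c"
    using assms R by (auto simp: k_def c_def frac_le)
  have h: "h = k / 2 - c" by (simp add: h_def k_def c_def)
  then show "0 \<le> h" using k by simp
  show "h * D \<le> 1 / 2"
    using assms R by (simp add: h k_def left_diff_distrib c_def)
  have d2: "1 / (4 * d\<^sup>2) \<le> k\<^sup>2 / 4"
  proof -
    have "1 / (4 * d\<^sup>2) \<le> 1 / (4 * D\<^sup>2)"
      using assms by (intro divide_left_mono) (auto intro!: mult_pos_pos power_mono)
    then show ?thesis by (simp add: k_def power_divide)
  qed
  have c2: "4 * c\<^sup>2 \<le> c * k"
    using mult_left_mono[OF k(2), of c] k(3) by (simp add: power2_eq_square)
  \<comment> \<open>The bound for \<alpha> = 1. The subtracted constant \<open>c\<close> in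
    \<open>h\<close> creates the term \<open>c * k\<close>, which leaves room for
    \<open>3 * c\<^sup>2\<close>.\<close>
  have 1: "h\<^sup>2 - k\<^sup>2 / 2 \<le> - (k\<^sup>2 / 4 + 3 * c\<^sup>2)"
    using c2 by (simp add: h power2_eq_square algebra_simps)
  \<comment> \<open>The bound for \<alpha> = 0, where \<open>2 * \<epsilon> \<le> D\<close> makes
    the divergence term strong enough.\<close>
  have 2: "k\<^sup>2 / 4 + 3 * c\<^sup>2 \<le> h / \<epsilon>"
  proof -
    have "c * k \<le> k\<^sup>2 / 4"
      using mult_right_mono[OF k(2), of k] k(1) by (simp add: power2_eq_square)
    then have "k\<^sup>2 / 4 + 3 * c\<^sup>2 \<le> k\<^sup>2 / 2"
      using c2 zero_le_power2[of k] by linarith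
    also have "\<dots> = k / 4 * (2 * k)" by (simp add: power2_eq_square)
    also have "\<dots> \<le> h * (1 / \<epsilon>)"
    proof (rule mult_mono)
      show "k / 4 \<le> h" using k by (simp add: h)
      show "2 * k \<le> 1 / \<epsilon>" using assms by (simp add: k_def field_simps)
    qed (use \<open>0 \<le> h\<close> k in auto)
    finally show ?thesis by simp
  qed
  have combine: "\<alpha> * z - (1 - \<alpha>) * x + y \<le> 0"
    if "\<alpha> * z \<le> \<alpha> * (- y)" "(1 - \<alpha>) * y \<le> (1 - \<alpha>) * x" for x y z :: real
    using that by (simp add: algebra_simps)
  have "\<alpha> * (h\<^sup>2 - k\<^sup>2 / 2) \<le> \<alpha> * (- (k\<^sup>2 / 4 + 3 * c\<^sup>2))"
    using 1 assms by (intro mult_left_mono) auto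
  moreover have "(1 - \<alpha>) * (k\<^sup>2 / 4 + 3 * c\<^sup>2) \<le> (1 - \<alpha>) * (h / \<epsilon>)"
    using 2 assms by (intro mult_left_mono) auto
  ultimately have "\<alpha> * (h\<^sup>2 - k\<^sup>2 / 2) - (1 - \<alpha>) * (h / \<epsilon>) + (k\<^sup>2 / 4 + 3 * c\<^sup>2) \<le> 0"
    by (rule combine)
  moreover have "\<alpha> * (h\<^sup>2 - k\<^sup>2 / 2) = h\<^sup>2 * \<alpha> - \<alpha> / (2 * D\<^sup>2)"
    by (simp add: k_def power_divide right_diff_distrib)
  moreover have "h * ((1 - \<alpha>) / \<epsilon>) = (1 - \<alpha>) * (h / \<epsilon>)" by simp
  ultimately show "h\<^sup>2 * \<alpha> - \<alpha> / (2 * D\<^sup>2) - h * ((1 - \<alpha>) / \<epsilon>) + 3 * c\<^sup>2 + 1 / (4 * d\<^sup>2) \<le> 0"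
    using d2 by linarith
qed

text \<open>With \<open>\<psi> > 0\<close> satisfying \<open>\<nabla>\<psi> / \<psi> = h \<nabla>D\<close>, the field \<open>G = \<nabla>u - u h \<nabla>D\<close> is
  \<open>\<psi> \<nabla>(u / \<psi>)\<close>, the remainder of the ground state substitution.\<close>

lemma ex_ground_state_remainder:
  fixes \<Omega> :: "'a::euclidean_space set" and u :: "'a \<Rightarrow> real"
  assumes \<Omega>: "open \<Omega>" "convex \<Omega>" "bounded \<Omega>"
    and K: "compact K" "K \<subseteq> \<Omega>"
    and u: "\<And>x. (u has_derivative (\<lambda>v. gu x \<bullet> v)) (at x)" "continuous_on UNIV gu"
      "\<And>x. x \<notin> K \<Longrightarrow> u x = 0"
    and x0: "x0 \<in> \<Omega>" and R: "\<And>x. x \<in> \<Omega> \<Longrightarrow> infdist x (frontier \<Omega>) \<le> R"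
    and \<Delta>: "\<And>x. x \<in> \<Omega> \<Longrightarrow> norm (x0 - x) \<le> \<Delta>" and s: "1 < s"
  obtains G :: "'a \<Rightarrow> 'a" where "continuous_on K G" "\<And>x. x \<notin> K \<Longrightarrow> G x = 0"
    "(LINT x|lborel. (norm (G x))\<^sup>2) + 3 * (1 / (4 * R))\<^sup>2 * (LINT x|lborel. (u x)\<^sup>2)
      \<le> (LINT x|lborel. (norm (gu x))\<^sup>2 - 1 / (4 * (infdist x (frontier \<Omega>))\<^sup>2) * (u x)\<^sup>2)"
    "infdist x0 (frontier \<Omega>) / 2 * (LINT x|lborel. norm ((s * \<bar>u x\<bar> powr (s - 1) * sgn (u x)) *\<^sub>R gu x))
      \<le> (infdist x0 (frontier \<Omega>) / 2 + \<Delta>) * s * (LINT x|lborel. \<bar>u x\<bar> powr (s - 1) * norm (G x))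
        + (s / 2 + DIM('a)) * (LINT x|lborel. \<bar>u x\<bar> powr s)"
proof -
  let ?d = "\<lambda>x. infdist x (frontier \<Omega>)"
  \<comment> \<open>The point \<open>x0\<close> is included so that the lower bound for
    \<open>D\<close> is also available there; the concavity step below uses it.\<close>
  have K': "compact (insert x0 K)" "insert x0 K \<subseteq> \<Omega>" "insert x0 K \<noteq> {}"
    using K x0 by (auto intro: compact_insert)
  obtain D A A' and \<epsilon> :: real where
    D: "\<And>x. (D has_derivative (\<lambda>v. A x \<bullet> v)) (at x)" and
    A: "\<And>x. (A has_derivative A' x) (at x)" "\<And>v. continuous_on UNIV (\<lambda>x. A' x v)"
      "\<And>x. norm (A x) \<le> 1" and
    conc: "\<And>x z. D z \<le> D x + A x \<bullet> (z - x)" and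
    trace: "\<And>x. (\<Sum>b\<in>Basis. A' x b \<bullet> b) = - (1 - (norm (A x))\<^sup>2) / \<epsilon>" and
    \<epsilon>: "0 < \<epsilon>" "\<And>x. x \<in> insert x0 K \<Longrightarrow> 2 * \<epsilon> \<le> D x" and
    Dd: "\<And>x. x \<in> insert x0 K \<Longrightarrow> ?d x / 2 \<le> D x" "\<And>x. x \<in> insert x0 K \<Longrightarrow> D x \<le> ?d x"
    by (rule ex_smooth_concave_distance[OF \<Omega> K']) (rule that)
  define U where "U = {x. 0 < D x}"
  have contD: "continuous_on UNIV D"
    by (intro continuous_at_imp_continuous_on ballI has_derivative_continuous[OF D])
  have contA: "continuous_on UNIV A"
    by (intro continuous_at_imp_continuous_on ballI has_derivative_continuous[OF A(1)])
  have contu: "continuous_on UNIV u"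
    by (intro continuous_at_imp_continuous_on ballI has_derivative_continuous[OF u(1)])
  note contK = contD[THEN continuous_on_subset[OF _ subset_UNIV]] contA[THEN continuous_on_subset[OF _ subset_UNIV]]
    contu[THEN continuous_on_subset[OF _ subset_UNIV]] u(2)[THEN continuous_on_subset[OF _ subset_UNIV]]
  have U: "open U" "K \<subseteq> U"
    using \<epsilon> by (auto simp: U_def intro!: open_Collect_less contD continuous_on_const) force
  define c where "c = 1 / (4 * R)"
  define h where "h x = 1 / (2 * D x) - c" for x
  define H where "H x = h x *\<^sub>R A x" for x
  define H' where "H' x v = (- (1 / (2 * (D x)\<^sup>2)) * (A x \<bullet> v)) *\<^sub>R A x + h x *\<^sub>R A' x v" for x v
  define G where "G x = gu x - u x *\<^sub>R H x" for x
  have gu0: "gu x = 0" if "x \<notin> K" for x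
    using has_derivative_zero_outside_support[OF u(1) compact_imp_closed[OF K(1)] u(3) that, of "gu x"]
    by simp
  have weight: "(h x)\<^sup>2 * (norm (A x))\<^sup>2 - (norm (A x))\<^sup>2 / (2 * (D x)\<^sup>2) - h x * ((1 - (norm (A x))\<^sup>2) / \<epsilon>)
      + 3 * c\<^sup>2 + 1 / (4 * (?d x)\<^sup>2) \<le> 0" "0 \<le> h x" "h x * D x \<le> 1 / 2" if "x \<in> K" for x
  proof -
    have "0 < D x" "2 * \<epsilon> \<le> D x" "D x \<le> ?d x" "?d x \<le> R"
      using \<epsilon>(1) \<epsilon>(2)[of x] Dd(2)[of x] R[of x] that K(2) by auto
    moreover from this have "D x \<le> R" by simp
    moreover have "(norm (A x))\<^sup>2 \<le> 1" using A(3)[of x] by (simp add: power_le_one)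
    ultimately show "(h x)\<^sup>2 * (norm (A x))\<^sup>2 - (norm (A x))\<^sup>2 / (2 * (D x)\<^sup>2) - h x * ((1 - (norm (A x))\<^sup>2) / \<epsilon>)
      + 3 * c\<^sup>2 + 1 / (4 * (?d x)\<^sup>2) \<le> 0" "0 \<le> h x" "h x * D x \<le> 1 / 2"
      using hardy_weight_inequality[of "D x" R "?d x" \<epsilon> "(norm (A x))\<^sup>2"] \<epsilon>(1)
      unfolding h_def c_def by auto
  qed
  have H: "(H has_derivative H' x) (at x)" if "x \<in> U" for x
  proof -
    have "D x \<noteq> 0" using that by (simp add: U_def)
    then have "(h has_derivative (\<lambda>v. - (1 / (2 * (D x)\<^sup>2)) * (A x \<bullet> v))) (at x)"
      unfolding h_def[abs_def]
      by (auto intro!: derivative_eq_intros D simp: power2_eq_square field_simps)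
    from has_derivative_scaleR[OF this A(1)] show ?thesis
      unfolding H_def[abs_def] H'_def[abs_def] by (simp add: add.commute)
  qed
  have conth: "continuous_on S h" if "S \<subseteq> U" for S
    unfolding h_def[abs_def] using that by (intro continuous_intros contK) (auto simp: U_def)
  have contH': "continuous_on U (\<lambda>x. H' x b)" for b
    unfolding H'_def
    by (intro continuous_intros conth contK A(2)[THEN continuous_on_subset[OF _ subset_UNIV]]) (auto simp: U_def)
  have traceH: "(\<Sum>b\<in>Basis. H' x b \<bullet> b) = - (norm (A x))\<^sup>2 / (2 * (D x)\<^sup>2) - h x * ((1 - (norm (A x))\<^sup>2) / \<epsilon>)" for x
  proof -
    have "H' x b \<bullet> b = - (1 / (2 * (D x)\<^sup>2)) * ((A x \<bullet> b) * (A x \<bullet> b)) + h x * (A' x b \<bullet> b)" for b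
      unfolding H'_def by (simp only: inner_add_left inner_scaleR_left mult.assoc)
    then have "(\<Sum>b\<in>Basis. H' x b \<bullet> b) = - (1 / (2 * (D x)\<^sup>2)) * (A x \<bullet> A x) + h x * (\<Sum>b\<in>Basis. A' x b \<bullet> b)"
      unfolding euclidean_inner[of "A x" "A x"] sum_distrib_left sum.distrib[symmetric] by (intro sum.cong refl)
    then show ?thesis unfolding trace by (simp add: power2_norm_eq_inner del: minus_diff_eq)
  qed
  have contG: "continuous_on K G"
    unfolding G_def[abs_def] H_def[abs_def] by (intro continuous_intros contK conth U(2))
  have G0: "G x = 0" if "x \<notin> K" for x
    using that by (simp add: G_def u(3) gu0)
  note intK = integrable_lborel_compact_support[OF K(1)]
  have int_G2: "integrable lborel (\<lambda>x. (norm (G x))\<^sup>2)"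
    by (rule intK) (auto intro!: continuous_intros contG simp: G0)
  have int_u2: "integrable lborel (\<lambda>x. (u x)\<^sup>2)"
    by (rule intK) (auto intro!: continuous_intros contK simp: u(3))
  have int_E: "integrable lborel (\<lambda>x. (norm (gu x))\<^sup>2 - 1 / (4 * (?d x)\<^sup>2) * (u x)\<^sup>2)"
  proof (rule intK)
    have "?d x \<noteq> 0" if "x \<in> K" for x using \<epsilon>(1) \<epsilon>(2)[of x] Dd(2)[of x] that by auto
    then show "continuous_on K (\<lambda>x. (norm (gu x))\<^sup>2 - 1 / (4 * (?d x)\<^sup>2) * (u x)\<^sup>2)"
      by (intro continuous_intros contK) auto
  qed (simp add: u(3) gu0)
  have du2: "((\<lambda>x. (u x)\<^sup>2) has_derivative (\<lambda>v. ((2 * u x) *\<^sub>R gu x) \<bullet> v)) (at x)" for x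
    by (auto intro!: derivative_eq_intros u(1))
  have cdu2: "continuous_on UNIV (\<lambda>x. (2 * u x) *\<^sub>R gu x)"
    by (intro continuous_intros contu u(2))
  have u20: "(u x)\<^sup>2 = 0" if "x \<notin> K" for x using u(3)[OF that] by simp
  \<comment> \<open>The divergence of \<open>H\<close> times the square of \<open>u\<close>; its
    integral vanishes.\<close>
  let ?V = "\<lambda>x. ((2 * u x) *\<^sub>R gu x) \<bullet> H x + (u x)\<^sup>2 * (\<Sum>b\<in>Basis. H' x b \<bullet> b)"
  have V: "(LINT x|lborel. ?V x) = 0" "integrable lborel ?V"
    using integral_divergence_mult_eq_0[OF du2 cdu2 K(1) u20 U H contH'] by auto
  \<comment> \<open>Expanding the square of \<open>G\<close> and cancelling the mixed term against
    the one in \<open>?V\<close> leaves the weight inequality multiplied by the square of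
    \<open>u\<close>.\<close>
  have "(norm (G x))\<^sup>2 + 3 * c\<^sup>2 * (u x)\<^sup>2 \<le> (norm (gu x))\<^sup>2 - 1 / (4 * (?d x)\<^sup>2) * (u x)\<^sup>2 - ?V x" for x
  proof (cases "x \<in> K")
    case True
    have "(norm (G x))\<^sup>2 = (norm (gu x))\<^sup>2 - 2 * u x * (gu x \<bullet> H x) + (u x)\<^sup>2 * ((h x)\<^sup>2 * (norm (A x))\<^sup>2)"
      unfolding G_def H_def power2_norm_eq_inner
      by (simp add: inner_diff_left inner_diff_right inner_commute power2_eq_square algebra_simps)
    moreover have "(u x)\<^sup>2 * ((h x)\<^sup>2 * (norm (A x))\<^sup>2 - (norm (A x))\<^sup>2 / (2 * (D x)\<^sup>2) - h x * ((1 - (norm (A x))\<^sup>2) / \<epsilon>)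
      + 3 * c\<^sup>2 + 1 / (4 * (?d x)\<^sup>2)) \<le> 0"
      using weight(1)[OF True] by (intro mult_nonneg_nonpos) auto
    ultimately show ?thesis unfolding traceH by (simp add: algebra_simps)
  qed (simp add: G0 gu0 u(3))
  then have "(LINT x|lborel. (norm (G x))\<^sup>2 + 3 * c\<^sup>2 * (u x)\<^sup>2)
      \<le> (LINT x|lborel. (norm (gu x))\<^sup>2 - 1 / (4 * (?d x)\<^sup>2) * (u x)\<^sup>2 - ?V x)"
    using Bochner_Integration.integrable_diff[OF int_E V(2)] int_G2 int_u2
    by (intro integral_mono) auto
  also have "\<dots> = (LINT x|lborel. (norm (gu x))\<^sup>2 - 1 / (4 * (?d x)\<^sup>2) * (u x)\<^sup>2)"
    using Bochner_Integration.integral_diff[OF int_E V(2)] V(1) by simp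
  finally have part1: "(LINT x|lborel. (norm (G x))\<^sup>2) + 3 * c\<^sup>2 * (LINT x|lborel. (u x)\<^sup>2)
      \<le> (LINT x|lborel. (norm (gu x))\<^sup>2 - 1 / (4 * (?d x)\<^sup>2) * (u x)\<^sup>2)"
    using int_G2 int_u2 by simp

  define \<rho> where "\<rho> = ?d x0 / 2"
  define gf where "gf x = (s * \<bar>u x\<bar> powr (s - 1) * sgn (u x)) *\<^sub>R gu x" for x
  have df: "((\<lambda>x. \<bar>u x\<bar> powr s) has_derivative (\<lambda>v. gf x \<bullet> v)) (at x)" for x
    using has_derivative_compose[OF u(1) abs_powr_has_real_derivative[OF s, of "u x",
        unfolded has_field_derivative_def]]
    by (simp add: gf_def mult_ac)
  have cdf: "continuous_on UNIV gf"
  proof -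
    have "continuous_on UNIV (\<lambda>x. (s * (\<bar>u x\<bar> powr (s - 1) * sgn (u x))) *\<^sub>R gu x)"
      using s by (intro continuous_intros continuous_abs_powr_sgn contu u(2)) auto
    then show ?thesis by (simp add: gf_def[abs_def] mult.assoc)
  qed
  have f0: "\<bar>u x\<bar> powr s = 0" if "x \<notin> K" for x using u(3)[OF that] by simp
  have gf0: "gf x = 0" if "x \<notin> K" for x using gu0[OF that] by (simp add: gf_def)
  have dY: "((\<lambda>x. x0 - x) has_derivative (\<lambda>v. - v)) (at x)" for x :: 'a
    by (auto intro!: derivative_eq_intros)
  \<comment> \<open>The divergence of \<open>\<bar>u x\<bar> powr s\<close> times the field
    \<open>x0 - x\<close>, whose own divergence is minus the dimension.\<close>
  let ?Z = "\<lambda>x. gf x \<bullet> (x0 - x) + \<bar>u x\<bar> powr s * (\<Sum>b\<in>Basis. - (b::'a) \<bullet> b)"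
  have Z: "(LINT x|lborel. ?Z x) = 0" "integrable lborel ?Z"
    using integral_divergence_mult_eq_0[OF df cdf K(1) f0 open_UNIV subset_UNIV dY continuous_on_const]
    by auto
  have int_gf: "integrable lborel (\<lambda>x. norm (gf x))"
    by (rule intK) (auto intro!: continuous_intros cdf[THEN continuous_on_subset[OF _ subset_UNIV]] simp: gf0)
  have cpow: "continuous_on K (\<lambda>x. \<bar>u x\<bar> powr r)" if "0 < r" for r
    using that by (intro continuous_on_powr' continuous_intros contK) auto
  have int_PG: "integrable lborel (\<lambda>x. \<bar>u x\<bar> powr (s - 1) * norm (G x))"
    by (rule intK) (use s in \<open>auto intro!: continuous_intros cpow contG simp: G0\<close>)
  have int_f: "integrable lborel (\<lambda>x. \<bar>u x\<bar> powr s)"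
    by (rule intK) (use s in \<open>auto intro!: cpow simp: u(3)\<close>)
  have int_b: "integrable lborel (\<lambda>x. (\<rho> + \<Delta>) * s * (\<bar>u x\<bar> powr (s - 1) * norm (G x))
      + (s / 2 + DIM('a)) * \<bar>u x\<bar> powr s)"
    by (intro Bochner_Integration.integrable_add integrable_mult_right int_PG int_f)
  \<comment> \<open>Bounding \<open>gu\<close> by \<open>G\<close> and \<open>h\<close> times
    \<open>u\<close> leaves a singular term with the factor \<open>\<rho> * h x\<close>. The radial
    field in \<open>?Z\<close> produces the same term and absorbs it, at the price of multiples of
    \<open>norm (G x)\<close> and of \<open>\<bar>u x\<bar> powr s\<close>.\<close>
  have "\<rho> * norm (gf x) \<le> (\<rho> + \<Delta>) * s * (\<bar>u x\<bar> powr (s - 1) * norm (G x))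
      + (s / 2 + DIM('a)) * \<bar>u x\<bar> powr s + ?Z x" for x
  proof (cases "x \<in> K")
    case True
    define P where "P = s * \<bar>u x\<bar> powr (s - 1)"
    have P: "0 \<le> P" using s by (simp add: P_def)
    have Pu: "s * \<bar>u x\<bar> powr s = P * \<bar>u x\<bar>"
      by (cases "u x = 0") (auto simp: P_def powr_diff)
    have \<rho>: "0 \<le> \<rho>" by (simp add: \<rho>_def infdist_nonneg)
    have gu: "gu x = G x + (u x * h x) *\<^sub>R A x" by (simp add: G_def H_def)
    have su: "sgn (u x) * u x = \<bar>u x\<bar>" by (simp add: sgn_if)
    have "norm (gu x) \<le> norm (G x) + \<bar>u x\<bar> * h x * norm (A x)"
      unfolding gu using norm_triangle_ineq[of "G x" "(u x * h x) *\<^sub>R A x"] weight(2)[OF True]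
      by (simp add: abs_mult)
    also have "\<dots> \<le> norm (G x) + \<bar>u x\<bar> * h x"
      using A(3)[of x] weight(2)[OF True] by (simp add: mult_left_le)
    finally have "P * norm (gu x) \<le> P * (norm (G x) + \<bar>u x\<bar> * h x)"
      using P by (rule mult_left_mono)
    moreover have "norm (gf x) \<le> P * norm (gu x)"
      using s by (auto simp: gf_def P_def abs_mult sgn_if)
    ultimately have "\<rho> * norm (gf x) \<le> \<rho> * (P * (norm (G x) + \<bar>u x\<bar> * h x))"
      using \<rho> by (intro mult_left_mono) auto
    moreover have "- (P * norm (G x) * \<Delta>) + P * \<bar>u x\<bar> * (\<rho> * h x - 1 / 2) \<le> gf x \<bullet> (x0 - x)"
    proof -
      have "gf x \<bullet> (x0 - x) = P * (sgn (u x) * (G x \<bullet> (x0 - x))) + P * (sgn (u x) * u x) * (h x * (A x \<bullet> (x0 - x)))"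
        unfolding gf_def gu P_def by (simp add: inner_add_left algebra_simps)
      moreover have "- (norm (G x) * \<Delta>) \<le> sgn (u x) * (G x \<bullet> (x0 - x))"
      proof -
        have "\<bar>sgn (u x) * (G x \<bullet> (x0 - x))\<bar> \<le> \<bar>G x \<bullet> (x0 - x)\<bar>"
          by (auto simp: abs_mult sgn_if)
        also have "\<dots> \<le> norm (G x) * norm (x0 - x)" by (rule Cauchy_Schwarz_ineq2)
        also have "\<dots> \<le> norm (G x) * \<Delta>"
          using \<Delta> True K(2) by (intro mult_left_mono) auto
        finally show ?thesis by linarith
      qed
      then have "P * (- (norm (G x) * \<Delta>)) \<le> P * (sgn (u x) * (G x \<bullet> (x0 - x)))"
        using P by (rule mult_left_mono)
      \<comment> \<open>Concavity of \<open>D\<close> between \<open>x\<close> and \<open>x0\<close>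
        gives \<open>\<rho> - D x\<close> as a lower bound for the inner product; multiplied by
        \<open>h x\<close>, the negative part costs at most 1/2.\<close>
      moreover have "\<rho> * h x - 1 / 2 \<le> h x * (A x \<bullet> (x0 - x))"
      proof -
        have "\<rho> - D x \<le> A x \<bullet> (x0 - x)"
          using conc[of x0 x] Dd(1)[of x0] by (simp add: \<rho>_def)
        then have "h x * (\<rho> - D x) \<le> h x * (A x \<bullet> (x0 - x))"
          using weight(2)[OF True] by (rule mult_left_mono)
        then show ?thesis using weight(3)[OF True] by (simp add: algebra_simps)
      qed
      then have "P * \<bar>u x\<bar> * (\<rho> * h x - 1 / 2) \<le> P * \<bar>u x\<bar> * (h x * (A x \<bullet> (x0 - x)))"
        using P by (intro mult_left_mono) auto
      ultimately show ?thesis unfolding su by simp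
    qed
    moreover have "\<bar>u x\<bar> powr s * (\<Sum>b\<in>Basis. - (b::'a) \<bullet> b) = - (DIM('a) * \<bar>u x\<bar> powr s)"
      by (simp add: sum_negf inner_Basis)
    moreover have "(\<rho> + \<Delta>) * s * (\<bar>u x\<bar> powr (s - 1) * norm (G x)) = (\<rho> + \<Delta>) * (P * norm (G x))"
      by (simp add: P_def)
    moreover have "(s / 2 + DIM('a)) * \<bar>u x\<bar> powr s = P * \<bar>u x\<bar> / 2 + DIM('a) * \<bar>u x\<bar> powr s"
      using Pu by (simp add: distrib_right)
    ultimately show ?thesis by (simp add: algebra_simps)
  qed (simp add: G0 gf0 u(3))
  then have "(LINT x|lborel. \<rho> * norm (gf x)) \<le> (LINT x|lborel. (\<rho> + \<Delta>) * s * (\<bar>u x\<bar> powr (s - 1) * norm (G x))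
      + (s / 2 + DIM('a)) * \<bar>u x\<bar> powr s + ?Z x)"
    using int_gf Bochner_Integration.integrable_add[OF int_b Z(2)] by (intro integral_mono) auto
  also have "\<dots> = (LINT x|lborel. (\<rho> + \<Delta>) * s * (\<bar>u x\<bar> powr (s - 1) * norm (G x))
      + (s / 2 + DIM('a)) * \<bar>u x\<bar> powr s)"
    using Bochner_Integration.integral_add[OF int_b Z(2)] Z(1) by simp
  also have "\<dots> = (\<rho> + \<Delta>) * s * (LINT x|lborel. \<bar>u x\<bar> powr (s - 1) * norm (G x))
      + (s / 2 + DIM('a)) * (LINT x|lborel. \<bar>u x\<bar> powr s)"
    using int_PG int_f by simp
  finally have part2: "\<rho> * (LINT x|lborel. norm (gf x)) \<le> \<dots>" by simp
  show thesis
    by (rule that[of G])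
       (fact contG, erule G0, fact part1[unfolded c_def], fact part2[unfolded \<rho>_def gf_def])
qed

section \<open>The Hardy-Sobolev inequality for continuously differentiable functions with compact
  support\<close>

lemma hardy_sobolev_interpolation:
  fixes \<Omega> :: "'a::euclidean_space set"
  assumes dim: "DIM('a) \<ge> 2" and \<Omega>: "open \<Omega>" "convex \<Omega>" "bounded \<Omega>" "\<Omega> \<noteq> {}"
  shows "\<exists>C::real. C > 0 \<and> (\<forall>u gu K. compact K \<and> K \<subseteq> \<Omega> \<and>
    (\<forall>x. (u has_derivative (\<lambda>v. gu x \<bullet> v)) (at x)) \<and> continuous_on UNIV gu \<and>
    (\<forall>x. x \<notin> K \<longrightarrow> u x = 0) \<longrightarrow>
    C * (LINT x|lborel. \<bar>u x\<bar> powr (2 * (1 + 2 / DIM('a))))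
      \<le> (LINT x|lborel. (norm (gu x))\<^sup>2 - 1 / (4 * (infdist x (frontier \<Omega>))\<^sup>2) * (u x)\<^sup>2)
        * (LINT x|lborel. (u x)\<^sup>2) powr (2 / DIM('a)))"
proof -
  let ?d = "\<lambda>x. infdist x (frontier \<Omega>)"
  define N where "N = real DIM('a)"
  \<comment> \<open>Solves \<open>s * (N / (N - 1)) = q\<close>, so that the Sobolev inequality for
    \<open>\<bar>u x\<bar> powr s\<close> controls the power \<open>q\<close>. The exponent
    \<open>2 * (s - 1)\<close> is then the combination of 2 and \<open>q\<close> with weights
    \<open>2 / N\<close> and \<open>1 - 2 / N\<close>.\<close>
  define s where "s = 2 + 2 / N - 4 / N\<^sup>2"
  define q where "q = 2 * (1 + 2 / N)"
  have N: "2 \<le> N" using dim by (simp add: N_def)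
  have "4 / N\<^sup>2 \<le> 2 / N"
    using N by (simp add: power2_eq_square field_simps)
  then have s: "2 \<le> s" by (simp add: s_def)
  have sq: "s * (N / (N - 1)) = q"
    using N by (simp add: s_def q_def power2_eq_square divide_simps) (simp add: algebra_simps)
  have sm: "2 * (s - 1) = 2 * (2 / N) + q * (1 - 2 / N)"
    using N by (simp add: s_def q_def power2_eq_square divide_simps) (simp add: algebra_simps)

  obtain x0 where x0: "x0 \<in> \<Omega>" using \<Omega>(4) by blast
  have "frontier \<Omega> \<noteq> {}" using \<Omega> by (auto simp: frontier_eq_empty)
  moreover have "x0 \<notin> frontier \<Omega>" using \<Omega>(1) x0 by (simp add: frontier_def interior_open)
  ultimately have d0: "0 < ?d x0" by (auto intro!: infdist_pos_not_in_closed)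
  obtain \<Delta> where \<Delta>: "\<And>x. x \<in> \<Omega> \<Longrightarrow> norm (x0 - x) \<le> \<Delta>"
    using bounded_any_center[of \<Omega> x0] \<Omega>(3) by (auto simp: dist_norm)
  have "0 \<le> \<Delta>" using \<Delta>[OF x0] by simp
  \<comment> \<open>Bounds the distance function on \<Omega>, because that function is
    1-Lipschitz.\<close>
  define R where "R = ?d x0 + \<Delta>"
  have R: "?d x \<le> R" if "x \<in> \<Omega>" for x
    using infdist_triangle[of x "frontier \<Omega>" x0] \<Delta>[OF that] by (simp add: R_def dist_norm norm_minus_commute)
  have "0 < R" using d0 \<open>0 \<le> \<Delta>\<close> by (simp add: R_def)
  define \<rho> where "\<rho> = ?d x0 / 2"
  define \<kappa> where "\<kappa> = 3 * (1 / (4 * R))\<^sup>2"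
  have \<rho>: "0 < \<rho>" and \<kappa>: "0 < \<kappa>" using d0 \<open>0 < R\<close> by (auto simp: \<rho>_def \<kappa>_def)
  \<comment> \<open>The constant for which \<open>I \<le> C1 * sqrt (m * E)\<close> holds below; the
    division by \<rho> comes from the factor in front of the gradient integral.\<close>
  define C1 where "C1 = ((\<rho> + \<Delta>) * s + (s / 2 + N) / sqrt \<kappa>) / \<rho>"
  have C1: "0 < C1"
    using \<rho> \<kappa> s N \<open>0 \<le> \<Delta>\<close> by (auto simp: C1_def intro!: divide_pos_pos add_pos_pos mult_pos_pos add_pos_nonneg)

  have main: "1 / C1\<^sup>2 * (LINT x|lborel. \<bar>u x\<bar> powr q)
      \<le> (LINT x|lborel. (norm (gu x))\<^sup>2 - 1 / (4 * (?d x)\<^sup>2) * (u x)\<^sup>2)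
        * (LINT x|lborel. (u x)\<^sup>2) powr (2 / N)"
    if K: "compact K" "K \<subseteq> \<Omega>" and u: "\<And>x. (u has_derivative (\<lambda>v. gu x \<bullet> v)) (at x)" "continuous_on UNIV gu"
      "\<And>x. x \<notin> K \<Longrightarrow> u x = 0" for u gu K
  proof -
    have s1: "1 < s" using s by simp
    obtain G :: "'a \<Rightarrow> 'a" where G: "continuous_on K G" "\<And>x. x \<notin> K \<Longrightarrow> G x = 0" and
      G1: "(LINT x|lborel. (norm (G x))\<^sup>2) + 3 * (1 / (4 * R))\<^sup>2 * (LINT x|lborel. (u x)\<^sup>2)
        \<le> (LINT x|lborel. (norm (gu x))\<^sup>2 - 1 / (4 * (?d x)\<^sup>2) * (u x)\<^sup>2)" and
      G2: "?d x0 / 2 * (LINT x|lborel. norm ((s * \<bar>u x\<bar> powr (s - 1) * sgn (u x)) *\<^sub>R gu x))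
        \<le> (?d x0 / 2 + \<Delta>) * s * (LINT x|lborel. \<bar>u x\<bar> powr (s - 1) * norm (G x))
          + (s / 2 + DIM('a)) * (LINT x|lborel. \<bar>u x\<bar> powr s)"
      by (rule ex_ground_state_remainder[OF \<Omega>(1-3) K u x0 R \<Delta> s1], assumption, assumption, assumption) (rule that)
    define gf where "gf x = (s * \<bar>u x\<bar> powr (s - 1) * sgn (u x)) *\<^sub>R gu x" for x
    define E where "E = (LINT x|lborel. (norm (gu x))\<^sup>2 - 1 / (4 * (?d x)\<^sup>2) * (u x)\<^sup>2)"
    define a where "a = (LINT x|lborel. (u x)\<^sup>2)"
    define b where "b = (LINT x|lborel. \<bar>u x\<bar> powr q)"
    define m where "m = (LINT x|lborel. \<bar>u x\<bar> powr (2 * (s - 1)))"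
    define I where "I = (LINT x|lborel. norm (gf x))"
    have contu: "continuous_on S u" for S
      by (intro continuous_at_imp_continuous_on ballI has_derivative_continuous[OF u(1)])
    note intK = integrable_lborel_compact_support[OF K(1)]
    have cpow: "continuous_on S (\<lambda>x. \<bar>u x\<bar> powr r)" if "0 < r" for r S
      using that by (intro continuous_on_powr' continuous_intros contu) auto
    have int_pow: "integrable lborel (\<lambda>x. \<bar>u x\<bar> powr r)" if "0 < r" for r
      by (rule intK) (use that u(3) in \<open>simp_all add: cpow\<close>)
    have int_u2: "integrable lborel (\<lambda>x. (u x)\<^sup>2)"
      by (rule intK) (auto intro!: continuous_intros contu simp: u(3))
    have int_G2: "integrable lborel (\<lambda>x. (norm (G x))\<^sup>2)"
      by (rule intK) (auto intro!: continuous_intros G)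
    have q: "0 < q" using N by (auto simp: q_def intro!: add_pos_nonneg)
    have "0 \<le> a" "0 \<le> b" by (simp_all add: a_def b_def)
    have EG: "(LINT x|lborel. (norm (G x))\<^sup>2) + \<kappa> * a \<le> E"
      using G1 by (simp add: E_def a_def \<kappa>_def)
    have G2nn: "0 \<le> (LINT x|lborel. (norm (G x))\<^sup>2)" by simp
    have "0 \<le> \<kappa> * a" using \<kappa> \<open>0 \<le> a\<close> by simp
    \<comment> \<open>The case \<open>b = 0\<close> only needs \<open>E\<close> to be nonnegative.
      Otherwise a power of \<open>b\<close> can be cancelled at the end.\<close>
    have "1 / C1\<^sup>2 * b \<le> E * a powr (2 / N)"
    proof (cases "b = 0")
      case True
      have "0 \<le> E" using EG G2nn \<open>0 \<le> \<kappa> * a\<close> by linarith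
      then show ?thesis using True by simp
    next
      case False
      with \<open>0 \<le> b\<close> have b: "0 < b" by simp
      \<comment> \<open>If \<open>a\<close> or \<open>m\<close> were 0, then \<open>u\<close> would
        vanish almost everywhere; this gives the positivity required by the Cauchy-Schwarz and
        Hoelder lemmas.\<close>
      have nz: "\<not> (AE x in lborel. u x = 0)"
      proof
        assume "AE x in lborel. u x = 0"
        then have "AE x in lborel. \<bar>u x\<bar> powr q = 0" by eventually_elim simp
        then have "b = 0" unfolding b_def by (rule integral_eq_zero_AE)
        then show False using b by simp
      qed
      have a: "0 < a"
      proof (rule ccontr)
        assume "\<not> 0 < a"
        then have "a = 0" using \<open>0 \<le> a\<close> by linarith
        then have "(LINT x|lborel. (u x)\<^sup>2) = 0" unfolding a_def .
        then have "AE x in lborel. (u x)\<^sup>2 = 0"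
          using integral_nonneg_eq_0_iff_AE[OF int_u2] by simp
        then show False using nz by simp
      qed
      have m: "0 < m"
      proof (rule ccontr)
        assume "\<not> 0 < m"
        moreover have "0 \<le> m" by (simp add: m_def)
        ultimately have "m = 0" by linarith
        then have "(LINT x|lborel. \<bar>u x\<bar> powr (2 * (s - 1))) = 0" unfolding m_def .
        then have "AE x in lborel. \<bar>u x\<bar> powr (2 * (s - 1)) = 0"
          using integral_nonneg_eq_0_iff_AE[OF int_pow] s by simp
        then show False using nz by simp
      qed
      have E: "a \<le> E / \<kappa>" "(LINT x|lborel. (norm (G x))\<^sup>2) \<le> E" "0 < E"
      proof -
        have "\<kappa> * a \<le> E" using EG G2nn by linarith
        then show "a \<le> E / \<kappa>" using \<kappa> by (simp add: field_simps)
        show "(LINT x|lborel. (norm (G x))\<^sup>2) \<le> E" using EG \<open>0 \<le> \<kappa> * a\<close> by linarith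
        have "0 < \<kappa> * a" using \<kappa> a by simp
        then show "0 < E" using \<open>\<kappa> * a \<le> E\<close> by linarith
      qed
      have pow2: "(\<bar>u x\<bar> powr (s - 1))\<^sup>2 = \<bar>u x\<bar> powr (2 * (s - 1))" for x
        by (simp add: power2_eq_square flip: powr_add)
      have pow1: "\<bar>u x\<bar> powr (s - 1) * \<bar>u x\<bar> = \<bar>u x\<bar> powr s" for x
        using powr_add[of "\<bar>u x\<bar>" "s - 1" 1] by simp
      have int_p2: "integrable lborel (\<lambda>x. (\<bar>u x\<bar> powr (s - 1))\<^sup>2)"
        using int_pow[of "2 * (s - 1)"] s by (simp add: pow2)
      \<comment> \<open>Here and in \<open>i2\<close>, Cauchy-Schwarz splits off
        \<open>\<bar>u x\<bar> powr (s - 1)\<close>. The other factor is controlled by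
        \<open>E\<close>, which bounds both the integral of the square of \<open>G\<close> and
        \<open>\<kappa> * a\<close>.\<close>
      have i1: "(LINT x|lborel. \<bar>u x\<bar> powr (s - 1) * norm (G x)) \<le> sqrt (m * E)"
      proof (rule integral_mult_le_sqrt[OF int_p2 int_G2])
        show "integrable lborel (\<lambda>x. \<bar>u x\<bar> powr (s - 1) * norm (G x))"
          by (rule intK) (use s G in \<open>auto intro!: continuous_on_mult continuous_on_norm cpow\<close>)
      qed (use m E in \<open>simp_all add: pow2 m_def\<close>)
      have i2: "(LINT x|lborel. \<bar>u x\<bar> powr s) \<le> sqrt (m * (E / \<kappa>))"
      proof -
        have "(LINT x|lborel. \<bar>u x\<bar> powr (s - 1) * \<bar>u x\<bar>) \<le> sqrt (m * (E / \<kappa>))"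
        proof (rule integral_mult_le_sqrt[OF int_p2])
          show "integrable lborel (\<lambda>x. \<bar>u x\<bar> powr (s - 1) * \<bar>u x\<bar>)"
            using int_pow[of s] s by (simp add: pow1)
        qed (use m E \<kappa> int_u2 in \<open>simp_all add: pow2 m_def a_def\<close>)
        then show ?thesis by (simp add: pow1)
      qed
      have "\<rho> * I \<le> (\<rho> + \<Delta>) * s * sqrt (m * E) + (s / 2 + N) * sqrt (m * (E / \<kappa>))"
      proof -
        have "\<rho> * I \<le> (\<rho> + \<Delta>) * s * (LINT x|lborel. \<bar>u x\<bar> powr (s - 1) * norm (G x))
          + (s / 2 + N) * (LINT x|lborel. \<bar>u x\<bar> powr s)"
          using G2 unfolding I_def gf_def \<rho>_def N_def .
        also have "\<dots> \<le> (\<rho> + \<Delta>) * s * sqrt (m * E) + (s / 2 + N) * sqrt (m * (E / \<kappa>))"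
          using \<rho> \<open>0 \<le> \<Delta>\<close> s N by (intro add_mono mult_left_mono i1 i2) auto
        finally show ?thesis .
      qed
      also have "\<dots> = \<rho> * (C1 * sqrt (m * E))"
        using \<rho> by (simp add: C1_def real_sqrt_mult real_sqrt_divide field_simps)
      finally have I: "I \<le> C1 * sqrt (m * E)" using \<rho> by simp
      have I0: "0 \<le> I" by (simp add: I_def)

      have bI: "b \<le> I powr (N / (N - 1))"
      proof -
        have df: "((\<lambda>x. \<bar>u x\<bar> powr s) has_derivative (\<lambda>v. gf x \<bullet> v)) (at x)" for x
          using has_derivative_compose[OF u(1) abs_powr_has_real_derivative[OF s1, of "u x",
              unfolded has_field_derivative_def]]
          by (simp add: gf_def mult_ac)
        have "continuous_on UNIV (\<lambda>x. (s * (\<bar>u x\<bar> powr (s - 1) * sgn (u x))) *\<^sub>R gu x)"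
          using s by (intro continuous_intros continuous_abs_powr_sgn contu u(2)) auto
        then have cg: "continuous_on UNIV (\<lambda>x. norm (gf x))"
          by (intro continuous_intros) (simp add: gf_def[abs_def] mult.assoc)
        have "(LINT x|lborel. \<bar>\<bar>u x\<bar> powr s\<bar> powr (N / (N - 1))) \<le> I powr (N / (N - 1))"
          unfolding N_def I_def
        proof (rule gagliardo_nirenberg_sobolev[OF dim df cg _ K(1)])
          show "\<bar>gf x \<bullet> b\<bar> \<le> norm (gf x)" if "b \<in> Basis" for x b
            using Basis_le_norm[OF that] .
        qed (simp_all add: u(3) gf_def)
        then show ?thesis unfolding b_def by (simp only: abs_of_nonneg[OF powr_ge_zero] powr_powr sq)
      qed
      \<comment> \<open>Hoelder interpolation with the weights \<open>2 / N\<close> and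
        \<open>1 - 2 / N\<close>, which are nonnegative because \<open>2 \<le> N\<close>.\<close>
      have mab: "m \<le> a powr (2 / N) * b powr (1 - 2 / N)"
      proof -
        have "(LINT x|lborel. (u x)\<^sup>2 powr (2 / N) * (\<bar>u x\<bar> powr q) powr (1 - 2 / N))
            \<le> a powr (2 / N) * b powr (1 - 2 / N)"
          unfolding a_def b_def
          by (rule integral_powr_mult_powr_le[OF int_u2 int_pow[OF q]]) (use N a b in \<open>auto simp: a_def b_def\<close>)
        moreover have "(u x)\<^sup>2 powr (2 / N) * (\<bar>u x\<bar> powr q) powr (1 - 2 / N) = \<bar>u x\<bar> powr (2 * (s - 1))" for x
        proof (cases "u x = 0")
          case False
          then have "(u x)\<^sup>2 = \<bar>u x\<bar> powr 2" by simp
          then show ?thesis by (simp only: powr_powr sm powr_add[symmetric])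
        qed simp
        ultimately show ?thesis by (simp add: m_def)
      qed
      \<comment> \<open>This exponent turns the Sobolev bound into the square of \<open>I\<close>,
        and hence into a multiple of \<open>E * m\<close>.\<close>
      have "b powr (2 * (N - 1) / N) \<le> (I powr (N / (N - 1))) powr (2 * (N - 1) / N)"
        using bI b N by (intro powr_mono2) auto
      also have "\<dots> = I\<^sup>2"
      proof -
        have "N / (N - 1) * (2 * (N - 1) / N) = 2" using N by (simp add: field_simps)
        then show ?thesis using I0 by (cases "I = 0") (auto simp: powr_powr)
      qed
      also have "\<dots> \<le> (C1 * sqrt (m * E))\<^sup>2"
        using I I0 by (intro power_mono)
      also have "\<dots> = C1\<^sup>2 * E * m"
        using m E by (simp add: power_mult_distrib)
      also have "\<dots> \<le> C1\<^sup>2 * E * (a powr (2 / N) * b powr (1 - 2 / N))"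
        using mab E by (intro mult_left_mono) auto
      finally have "b powr (2 * (N - 1) / N) \<le> C1\<^sup>2 * E * a powr (2 / N) * b powr (1 - 2 / N)"
        by (simp add: mult.assoc)
      \<comment> \<open>The left side carries exactly one more power of \<open>b\<close> than the
        interpolation bound, so the common factor cancels.\<close>
      moreover have "b powr (2 * (N - 1) / N) = b * b powr (1 - 2 / N)"
      proof -
        have "2 * (N - 1) / N = 1 + (1 - 2 / N)" using N by (simp add: field_simps)
        then show ?thesis using b by (simp only: powr_add) simp
      qed
      ultimately have "b \<le> C1\<^sup>2 * E * a powr (2 / N)"
        using b by (simp add: mult_le_cancel_right)
      then show ?thesis using C1 by (simp add: field_simps)
    qed
    then show ?thesis by (simp only: E_def a_def b_def)
  qed
  show ?thesis
  proof (intro exI[of _ "1 / C1\<^sup>2"] conjI allI impI)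
    show "0 < 1 / C1\<^sup>2" using C1 by simp
  qed (use main[unfolded N_def q_def] in blast)
qed

section \<open>Transfer to test functions and to integrals over the domain\<close>

theorem theorem4p3:
  fixes \<Omega> :: "(real ^ 'n) set"
  assumes "CARD('n) \<ge> 2"
    and "smooth_domain \<Omega>" and "bounded \<Omega>" and "convex \<Omega>"
  shows "\<exists>C::real. C > 0 \<and> (\<forall>u \<in> test_functions \<Omega>.
      (LINT x:\<Omega>|lborel. (norm (gradient u x))\<^sup>2 - 1 / (4 * (bdist \<Omega> x)\<^sup>2) * (u x)\<^sup>2)
        * (LINT x:\<Omega>|lborel. (u x)\<^sup>2) powr (2 / real CARD('n))
      \<ge> C * (LINT x:\<Omega>|lborel. \<bar>u x\<bar> powr (2 * (1 + 2 / real CARD('n)))))"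
proof -
  have \<Omega>: "open \<Omega>" "convex \<Omega>" "bounded \<Omega>" "\<Omega> \<noteq> {}"
    using assms by (auto simp: smooth_domain_def)
  have dim: "DIM(real ^ 'n) \<ge> 2" using assms(1) by simp
  from hardy_sobolev_interpolation[OF dim \<Omega>]
  obtain C :: real where C: "0 < C" "\<forall>u gu K. compact K \<and> K \<subseteq> \<Omega> \<and>
    (\<forall>x. (u has_derivative (\<lambda>v. gu x \<bullet> v)) (at x)) \<and> continuous_on UNIV gu \<and>
    (\<forall>x. x \<notin> K \<longrightarrow> u x = 0) \<longrightarrow>
    C * (LINT x|lborel. \<bar>u x\<bar> powr (2 * (1 + 2 / DIM(real ^ 'n))))
      \<le> (LINT x|lborel. (norm (gu x))\<^sup>2 - 1 / (4 * (infdist x (frontier \<Omega>))\<^sup>2) * (u x)\<^sup>2)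
        * (LINT x|lborel. (u x)\<^sup>2) powr (2 / DIM(real ^ 'n))"
    by (elim exE conjE)
  show ?thesis
  proof (intro exI conjI ballI)
    show "0 < C" by (rule C(1))
    fix u assume "u \<in> test_functions \<Omega>"
    define K where "K = closure {x. u x \<noteq> 0}"
    have K: "compact K" "K \<subseteq> \<Omega>" and Ck: "C_k 1 u"
      using \<open>u \<in> test_functions \<Omega>\<close> by (auto simp: test_functions_def K_def)
    have u0: "u x = 0" if "x \<notin> K" for x
      using that closure_subset[of "{x. u x \<noteq> 0}"] by (auto simp: K_def)
    have du: "(u has_derivative (\<lambda>v. gradient u x \<bullet> v)) (at x)" for x
      using GDERIV_gradient[of u x] Ck by (simp add: gderiv_def inner_commute)
    have cg: "continuous_on UNIV (gradient u)"
      unfolding gradient_def[abs_def] using Ck by (intro continuous_on_vec_lambda) simp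
    have g0: "gradient u x = 0" if "x \<notin> K" for x
      using has_derivative_zero_outside_support[OF du compact_imp_closed[OF K(1)] u0 that, of "gradient u x"]
      by simp
    \<comment> \<open>The support of \<open>u\<close> lies in \<Omega>, so integrands that vanish
      off it have the same integral over \<Omega> and over the whole space.\<close>
    have restrict: "(LINT x:\<Omega>|lborel. f x) = (LINT x|lborel. f x)" if "\<And>x. x \<notin> K \<Longrightarrow> f x = 0"
      for f :: "real ^ 'n \<Rightarrow> real"
      unfolding set_lebesgue_integral_def
      using that K(2) by (intro Bochner_Integration.integral_cong) (auto simp: indicator_def)
    have "(LINT x:\<Omega>|lborel. (norm (gradient u x))\<^sup>2 - 1 / (4 * (bdist \<Omega> x)\<^sup>2) * (u x)\<^sup>2)
        = (LINT x|lborel. (norm (gradient u x))\<^sup>2 - 1 / (4 * (infdist x (frontier \<Omega>))\<^sup>2) * (u x)\<^sup>2)"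
      unfolding bdist_def by (rule restrict) (simp add: g0 u0)
    moreover have "(LINT x:\<Omega>|lborel. (u x)\<^sup>2) = (LINT x|lborel. (u x)\<^sup>2)"
      by (rule restrict) (simp add: u0)
    moreover have "(LINT x:\<Omega>|lborel. \<bar>u x\<bar> powr (2 * (1 + 2 / real CARD('n))))
        = (LINT x|lborel. \<bar>u x\<bar> powr (2 * (1 + 2 / real CARD('n))))"
      by (rule restrict) (simp add: u0)
    ultimately show "(LINT x:\<Omega>|lborel. (norm (gradient u x))\<^sup>2 - 1 / (4 * (bdist \<Omega> x)\<^sup>2) * (u x)\<^sup>2)
        * (LINT x:\<Omega>|lborel. (u x)\<^sup>2) powr (2 / real CARD('n))
      \<ge> C * (LINT x:\<Omega>|lborel. \<bar>u x\<bar> powr (2 * (1 + 2 / real CARD('n))))"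
      using C(2)[rule_format, of K u "gradient u"] K du cg u0 by simp
  qed
qed

end
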